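(* Assume that $\Omega$ is a convex polygonal domain. Let $u$ be the solution of the variational problem: $u(t)\in V$, $u(0)=u^0$, $\dot u(0)=u^1$, and for $t\in(0,T)$ $$(\ddot u,v)+a(u,v)-\int_0^t\mathcal K(t-s)a(u(s),v)\,ds=(f,v)\qquad\forall v\in V.$$ Let $u_h$ be the solution of its finite element discretization: $u_h(t)\in V_h^l$, $u_h(0)=u_h^0$, $\dot u_h(0)=u_h^1$, and for $t\in(0,T)$ $$(\ddot u_h,v_h)+a(u_h,v_h)-\int_0^t\mathcal K(t-s)a(u_h(s),v_h)\,ds=(f,v_h)\qquad\forall v_h\in V_h^l,$$ where $u_h^0\in V_h^l$ and $u_h^1=\mathcal P_hu^1$. Then $$\|u_h(T)-u(T)\|\le C\|u_h^0-\mathcal R_hu^0\|+Ch^l\Big(\|u(T)\|_l+\int_0^T\|\dot u\|_l\,d\tau\Big),$$ with a constant $C$ independent of $h$ and $u$.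
   Context: Let $T>0$ be fixed. Write $H^s=H^s(\Omega)^d$, $H=L_2(\Omega)^d$ with norm $\|\cdot\|$ and inner product $(\cdot,\cdot)$, and $V=H_0^1(\Omega)^d$. $A$ is a self-adjoint, positive definite, uniformly elliptic second order operator on $H$ with $\mathcal D(A)=H^2\cap V$; $a(u,v)=(Au,v)$, extended to $V\times V$, is the energy inner product with norm $\|v\|_V^2=a(v,v)$, and $\|v\|_s=\|A^{s/2}v\|$. The elliptic regularity estimate $\|v\|_{2}\le C\|Av\|$ holds for $v\in\mathcal D(A)$. The kernel $\mathcal K$ (smooth, or at worst weakly singular at the origin) satisfies $\mathcal K\ge0$, $\dot{\mathcal K}\le0$ and $\|\mathcal K\|_{L_1(\mathbb R^+)}=\kappa<1$. $\{\mathcal T_h\}$ is a regular family of triangulations of $\Omega$, $h=\max_{K\in\mathcal T_h}\operatorname{diam}(K)$, and for an integer $l\ge2$, $V_h^l\subset V$ is the space of continuous piecewise polynomials of degree at most $l-1$ with respect to $\mathcal T_h$, vanishing on $\partial\Omega$. The $L_2$-projection $\mathcal P_h:H\to V_h^l$ and the Ritz projection $\mathcal R_h:V\to V_h^l$ are defined by $(\mathcal P_hv,\chi)=(v,\chi)$ and $a(\mathcal R_hv,\chi)=a(v,\chi)$ for all $\chi\in V_h^l$. It is a standing assumption that $$\|(\mathcal R_h-I)v\|+h\|(\mathcal R_h-I)v\|_1\le Ch^i\|v\|_i,\qquad v\in H^i\cap V,\ 1\le i\le l.$$ The solution $u$ is assumed regular enough for the equations and for the norms on the right-hand side of the estimate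 to make sense. *)

theory Defs
  imports "HOL-Analysis.Analysis"
begin

text \<open>
  Elements of $L_2(\Omega)^d$ are represented by functions on \<open>real ^ 'n\<close> with $d = $ \<open>CARD('n)\<close>; only
  their values almost everywhere in \<open>\<Omega>\<close> matter.
\<close>

type_synonym 'n field = "real ^ 'n \<Rightarrow> real ^ 'n"

definition ae_eq :: "(real ^ 'n::finite) set \<Rightarrow> 'n field \<Rightarrow> 'n field \<Rightarrow> bool" where
  "ae_eq \<Omega> v w \<longleftrightarrow> (AE x in lebesgue_on \<Omega>. v x = w x)"

definition L2 :: "(real ^ 'n::finite) set \<Rightarrow> 'n field set" where
  "L2 \<Omega> = {v. v \<in> borel_measurable (lebesgue_on \<Omega>) \<and>
              integrable (lebesgue_on \<Omega>) (\<lambda>x. (norm (v x))\<^sup>2)}"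

definition l2inner :: "(real ^ 'n::finite) set \<Rightarrow> 'n field \<Rightarrow> 'n field \<Rightarrow> real" where
  "l2inner \<Omega> v w = (\<integral>x. v x \<bullet> w x \<partial>lebesgue_on \<Omega>)"

definition l2norm :: "(real ^ 'n::finite) set \<Rightarrow> 'n field \<Rightarrow> real" where
  "l2norm \<Omega> v = sqrt (l2inner \<Omega> v v)"

definition polygonal_domain :: "(real ^ 'n::finite) set \<Rightarrow> bool" where
  "polygonal_domain \<Omega> \<longleftrightarrow> open \<Omega> \<and> \<Omega> \<noteq> {} \<and> convex \<Omega> \<and> polytope (closure \<Omega>)"


subsection \<open>Sobolev spaces\<close>

text \<open>
  Derivatives of order $k$ are indexed by lists $[j_1,\dots,j_k]$ of coordinate directions, denoting
  $\partial_{j_1}\cdots\partial_{j_k}$. A function all of whose iterated partial derivatives are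
  (Frechet) differentiable is of class $C^\infty$, and conversely.
\<close>

fun pderivs :: "'n::finite list \<Rightarrow> (real ^ 'n \<Rightarrow> real) \<Rightarrow> real ^ 'n \<Rightarrow> real" where
  "pderivs [] f = f"
| "pderivs (j # js) f = (\<lambda>x. frechet_derivative (pderivs js f) (at x) (axis j 1))"

definition test_function :: "(real ^ 'n::finite) set \<Rightarrow> (real ^ 'n \<Rightarrow> real) \<Rightarrow> bool" where
  "test_function \<Omega> \<phi> \<longleftrightarrow> (\<forall>js x. pderivs js \<phi> differentiable (at x)) \<and>
     compact (closure {x. \<phi> x \<noteq> 0}) \<and> closure {x. \<phi> x \<noteq> 0} \<subseteq> \<Omega>"

definition has_weak_deriv ::
    "(real ^ 'n::finite) set \<Rightarrow> 'n list \<Rightarrow> 'n field \<Rightarrow> 'n field \<Rightarrow> bool" where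
  "has_weak_deriv \<Omega> js v g \<longleftrightarrow> (\<forall>\<phi>. test_function \<Omega> \<phi> \<longrightarrow>
     (\<integral>x. pderivs js \<phi> x *\<^sub>R v x \<partial>lebesgue_on \<Omega>) =
       (-1) ^ length js *\<^sub>R (\<integral>x. \<phi> x *\<^sub>R g x \<partial>lebesgue_on \<Omega>))"

definition weak_deriv :: "(real ^ 'n::finite) set \<Rightarrow> 'n list \<Rightarrow> 'n field \<Rightarrow> 'n field" where
  "weak_deriv \<Omega> js v = (if js = [] then v else SOME g. g \<in> L2 \<Omega> \<and> has_weak_deriv \<Omega> js v g)"

definition sobolev :: "(real ^ 'n::finite) set \<Rightarrow> nat \<Rightarrow> 'n field set" where
  "sobolev \<Omega> s = {v \<in> L2 \<Omega>. \<forall>js. length js \<le> s \<longrightarrow> (\<exists>g\<in>L2 \<Omega>. has_weak_deriv \<Omega> js v g)}"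

text \<open>
  Mixed derivatives are counted once per ordering of the directions, so the square of this norm is
  $\sum_{k\le s}\|\nabla^k v\|^2$.
\<close>

definition sobolev_norm :: "(real ^ 'n::finite) set \<Rightarrow> nat \<Rightarrow> 'n field \<Rightarrow> real" where
  "sobolev_norm \<Omega> s v = sqrt (\<Sum>js | length js \<le> s. (l2norm \<Omega> (weak_deriv \<Omega> js v))\<^sup>2)"

text \<open>
  $H^1_0(\Omega)^d$, the closure of $C_c^\infty(\Omega)^d$ in $H^1(\Omega)^d$: test fields \<open>\<phi> n\<close>
  converge to \<open>v\<close> and their gradients to the weak gradient \<open>G\<close> of \<open>v\<close>, in $L_2$. The test fields
  are differentiated classically.
\<close>

definition H10 :: "(real ^ 'n::finite) set \<Rightarrow> 'n field set" where
  "H10 \<Omega> = {v \<in> sobolev \<Omega> 1. \<exists>(\<phi> :: nat \<Rightarrow> 'n field) G.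
     (\<forall>n k. test_function \<Omega> (\<lambda>x. \<phi> n x $ k)) \<and>
     (\<lambda>n. l2norm \<Omega> (\<lambda>x. \<phi> n x - v x)) \<longlonglongrightarrow> 0 \<and>
     (\<forall>j. G j \<in> L2 \<Omega> \<and> has_weak_deriv \<Omega> [j] v (G j) \<and>
        (\<lambda>n. l2norm \<Omega> (\<lambda>x. frechet_derivative (\<phi> n) (at x) (axis j 1) - G j x)) \<longlonglongrightarrow> 0)}"


subsection \<open>The elliptic operator and its energy form\<close>

definition op_domain :: "(real ^ 'n::finite) set \<Rightarrow> 'n field set" where
  "op_domain \<Omega> = sobolev \<Omega> 2 \<inter> H10 \<Omega>"

text \<open>
  The operator $v \mapsto \sum_{|\alpha|\le 2} c_\alpha\,\partial^\alpha v$ with bounded measurable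
  matrix coefficients; uniform ellipticity of the system is the Legendre-Hadamard condition on the
  second-order coefficients.
\<close>

definition elliptic_operator :: "(real ^ 'n::finite) set \<Rightarrow> ('n field \<Rightarrow> 'n field) \<Rightarrow> bool" where
  "elliptic_operator \<Omega> A \<longleftrightarrow> (\<exists>(c :: 'n list \<Rightarrow> real ^ 'n \<Rightarrow> real ^ 'n ^ 'n) M \<mu>.
     (\<forall>js. c js \<in> borel_measurable (lebesgue_on \<Omega>)) \<and>
     (\<forall>js. length js \<le> 2 \<longrightarrow> (\<forall>x\<in>\<Omega>. norm (c js x) \<le> M)) \<and>
     (\<forall>v\<in>op_domain \<Omega>.
        ae_eq \<Omega> (A v) (\<lambda>x. \<Sum>js | length js \<le> 2. c js x *v weak_deriv \<Omega> js v x)) \<and>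
     \<mu> > 0 \<and>
     (\<forall>x\<in>\<Omega>. \<forall>\<xi> \<eta>. \<mu> * (norm \<xi>)\<^sup>2 * (norm \<eta>)\<^sup>2 \<le>
        - (\<Sum>i\<in>UNIV. \<Sum>j\<in>UNIV. \<xi> $ i * \<xi> $ j * (\<eta> \<bullet> (c [i, j] x *v \<eta>)))))"

text \<open>
  For a densely defined symmetric operator the last clause says that the domain of the adjoint is
  contained in \<open>D\<close>. Linearity and compatibility with equality a.e. follow from the clauses.
\<close>

definition self_adjoint ::
    "(real ^ 'n::finite) set \<Rightarrow> 'n field set \<Rightarrow> ('n field \<Rightarrow> 'n field) \<Rightarrow> bool" where
  "self_adjoint \<Omega> D S \<longleftrightarrow> D \<subseteq> L2 \<Omega> \<and> S ` D \<subseteq> L2 \<Omega> \<and>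
     (\<forall>v\<in>L2 \<Omega>. \<forall>e>0. \<exists>w\<in>D. l2norm \<Omega> (\<lambda>x. v x - w x) < e) \<and>
     (\<forall>v\<in>D. \<forall>w\<in>D. l2inner \<Omega> (S v) w = l2inner \<Omega> v (S w)) \<and>
     (\<forall>w\<in>L2 \<Omega>. \<forall>g\<in>L2 \<Omega>. (\<forall>v\<in>D. l2inner \<Omega> (S v) w = l2inner \<Omega> v g) \<longrightarrow> w \<in> D)"

definition positive_definite ::
    "(real ^ 'n::finite) set \<Rightarrow> 'n field set \<Rightarrow> ('n field \<Rightarrow> 'n field) \<Rightarrow> bool" where
  "positive_definite \<Omega> D S \<longleftrightarrow> (\<forall>v\<in>D. \<not> ae_eq \<Omega> v (\<lambda>x. 0) \<longrightarrow> l2inner \<Omega> (S v) v > 0)"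

definition elliptic_regularity :: "(real ^ 'n::finite) set \<Rightarrow> ('n field \<Rightarrow> 'n field) \<Rightarrow> bool" where
  "elliptic_regularity \<Omega> A \<longleftrightarrow>
     (\<exists>C. \<forall>v\<in>op_domain \<Omega>. sobolev_norm \<Omega> 2 v \<le> C * l2norm \<Omega> (A v))"

text \<open>
  The extension of $(Au,v)$ to an inner product on $H^1_0(\Omega)^d$ whose norm is a norm of that
  space, i.e. equivalent to the $H^1$-norm. Since the domain of \<open>A\<close> is dense in $H^1_0(\Omega)^d$,
  this determines \<open>a\<close>.
\<close>

definition energy_form ::
    "(real ^ 'n::finite) set \<Rightarrow> ('n field \<Rightarrow> 'n field) \<Rightarrow> ('n field \<Rightarrow> 'n field \<Rightarrow> real) \<Rightarrow> bool" where
  "energy_form \<Omega> A a \<longleftrightarrow>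
     (\<forall>v\<in>op_domain \<Omega>. \<forall>w\<in>op_domain \<Omega>. a v w = l2inner \<Omega> (A v) w) \<and>
     (\<forall>v\<in>H10 \<Omega>. \<forall>w\<in>H10 \<Omega>. a v w = a w v) \<and>
     (\<forall>v\<in>H10 \<Omega>. \<forall>w\<in>H10 \<Omega>. \<forall>z\<in>H10 \<Omega>. a (\<lambda>x. v x + w x) z = a v z + a w z) \<and>
     (\<forall>r. \<forall>v\<in>H10 \<Omega>. \<forall>w\<in>H10 \<Omega>. a (\<lambda>x. r *\<^sub>R v x) w = r * a v w) \<and>
     (\<exists>m M. m > 0 \<and> (\<forall>v\<in>H10 \<Omega>.
        m * (sobolev_norm \<Omega> 1 v)\<^sup>2 \<le> a v v \<and> a v v \<le> M * (sobolev_norm \<Omega> 1 v)\<^sup>2))"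

text \<open>\<open>B\<close> with domain \<open>D\<close> is the nonnegative self-adjoint square root $A^{1/2}$.\<close>

definition is_sqrt_op ::
    "(real ^ 'n::finite) set \<Rightarrow> ('n field \<Rightarrow> 'n field) \<Rightarrow> 'n field set \<Rightarrow> ('n field \<Rightarrow> 'n field) \<Rightarrow> bool" where
  "is_sqrt_op \<Omega> A D B \<longleftrightarrow> self_adjoint \<Omega> D B \<and> (\<forall>v\<in>D. l2inner \<Omega> (B v) v \<ge> 0) \<and>
     op_domain \<Omega> = {v \<in> D. B v \<in> D} \<and> (\<forall>v\<in>op_domain \<Omega>. ae_eq \<Omega> (B (B v)) (A v))"

text \<open>
  The scale of spaces \<open>X i\<close> and norms \<open>N i\<close> in which regularity is measured. Two conventions for
  the norm $\|v\|_i$ on $H^i\cap V$ are in use: the Sobolev norm, and $\|A^{i/2}v\|$, the latter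
  being finite only on the domain of $A^{i/2}$. They are equivalent for $i\le 2$ but the domains
  differ for $i\ge 3$. Both are admitted.
\<close>

definition norm_scale ::
    "(real ^ 'n::finite) set \<Rightarrow> ('n field \<Rightarrow> 'n field) \<Rightarrow> (nat \<Rightarrow> 'n field set) \<Rightarrow>
      (nat \<Rightarrow> 'n field \<Rightarrow> real) \<Rightarrow> bool" where
  "norm_scale \<Omega> A X N \<longleftrightarrow>
     (\<exists>D B. is_sqrt_op \<Omega> A D B \<and>
        X = (\<lambda>i. {v \<in> sobolev \<Omega> i \<inter> H10 \<Omega>. \<forall>j<i. (B ^^ j) v \<in> D}) \<and>
        N = (\<lambda>i v. l2norm \<Omega> ((B ^^ i) v))) \<or>
     (X = (\<lambda>i. sobolev \<Omega> i \<inter> H10 \<Omega>) \<and> N = sobolev_norm \<Omega>)"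


subsection \<open>The memory kernel\<close>

definition memory_kernel :: "(real \<Rightarrow> real) \<Rightarrow> bool" where
  "memory_kernel K \<longleftrightarrow> (\<forall>t>0. K t \<ge> 0) \<and>
     (\<forall>t>0. \<exists>D\<le>0. (K has_real_derivative D) (at t)) \<and>
     set_integrable lborel {0<..} K \<and> (LBINT t:{0<..}. K t) < 1"


subsection \<open>Finite element spaces and projections\<close>

definition triangulation_of :: "(real ^ 'n::finite) set \<Rightarrow> (real ^ 'n) set set \<Rightarrow> bool" where
  "triangulation_of \<Omega> \<T> \<longleftrightarrow>
     triangulation \<T> \<and> (\<forall>S\<in>\<T>. int CARD('n) simplex S) \<and> \<Union>\<T> = closure \<Omega>"

definition regular_family :: "(real ^ 'n::finite) set \<Rightarrow> (real ^ 'n) set set set \<Rightarrow> bool" where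
  "regular_family \<Omega> \<TT> \<longleftrightarrow> (\<forall>\<T>\<in>\<TT>. triangulation_of \<Omega> \<T>) \<and>
     (\<exists>\<sigma>>0. \<forall>\<T>\<in>\<TT>. \<forall>S\<in>\<T>. \<exists>z. cball z (diameter S / \<sigma>) \<subseteq> S)"

definition mesh_size :: "(real ^ 'n::finite) set set \<Rightarrow> real" where
  "mesh_size \<T> = Max (diameter ` \<T>)"

definition polynomial_on ::
    "(real ^ 'n::finite) set \<Rightarrow> nat \<Rightarrow> 'n field \<Rightarrow> bool" where
  "polynomial_on S k v \<longleftrightarrow> (\<exists>c :: ('n \<Rightarrow> nat) \<Rightarrow> real ^ 'n.
     \<forall>x\<in>S. v x = (\<Sum>\<alpha> | sum \<alpha> UNIV \<le> k. (\<Prod>i\<in>UNIV. x $ i ^ \<alpha> i) *\<^sub>R c \<alpha>))"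

text \<open>Finite element functions are identified with their extension by zero outside \<open>\<Omega>\<close>.\<close>

definition fe_space ::
    "(real ^ 'n::finite) set \<Rightarrow> nat \<Rightarrow> (real ^ 'n) set set \<Rightarrow> 'n field set" where
  "fe_space \<Omega> l \<T> = {\<psi> \<in> H10 \<Omega>. continuous_on (closure \<Omega>) \<psi> \<and>
     (\<forall>S\<in>\<T>. polynomial_on S (l - 1) \<psi>) \<and> (\<forall>x. x \<notin> \<Omega> \<longrightarrow> \<psi> x = 0)}"

definition l2_projection ::
    "(real ^ 'n::finite) set \<Rightarrow> 'n field set \<Rightarrow> ('n field \<Rightarrow> 'n field) \<Rightarrow> bool" where
  "l2_projection \<Omega> W P \<longleftrightarrow>
     (\<forall>v\<in>L2 \<Omega>. P v \<in> W \<and> (\<forall>\<psi>\<in>W. l2inner \<Omega> (P v) \<psi> = l2inner \<Omega> v \<psi>))"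

definition ritz_projection ::
    "(real ^ 'n::finite) set \<Rightarrow> ('n field \<Rightarrow> 'n field \<Rightarrow> real) \<Rightarrow> 'n field set \<Rightarrow>
      ('n field \<Rightarrow> 'n field) \<Rightarrow> bool" where
  "ritz_projection \<Omega> a W R \<longleftrightarrow> (\<forall>v\<in>H10 \<Omega>. R v \<in> W \<and> (\<forall>\<psi>\<in>W. a (R v) \<psi> = a v \<psi>))"

definition ritz_estimate ::
    "(real ^ 'n::finite) set \<Rightarrow> (nat \<Rightarrow> 'n field set) \<Rightarrow> (nat \<Rightarrow> 'n field \<Rightarrow> real) \<Rightarrow> nat \<Rightarrow>
      (real ^ 'n) set set set \<Rightarrow> ((real ^ 'n) set set \<Rightarrow> 'n field \<Rightarrow> 'n field) \<Rightarrow> bool" where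
  "ritz_estimate \<Omega> X N l \<TT> R \<longleftrightarrow> (\<exists>C. \<forall>\<T>\<in>\<TT>. \<forall>i\<in>{1..l}. \<forall>v\<in>X i.
     l2norm \<Omega> (\<lambda>x. R \<T> v x - v x) + mesh_size \<T> * N 1 (\<lambda>x. R \<T> v x - v x)
       \<le> C * mesh_size \<T> ^ i * N i v)"


subsection \<open>The variational problem\<close>

text \<open>
  \<open>u\<close>, with first and second time derivatives \<open>u'\<close> and \<open>u''\<close>, solves the problem posed in the
  subspace \<open>W\<close> of $H^1_0(\Omega)^d$. The regularity in time that gives a meaning to the equation is
  part of the notion: \<open>u\<close> is differentiable into $H^1_0(\Omega)^d$ on $[0,T]$, and \<open>u'\<close> is
  continuous into $L_2(\Omega)^d$ on $[0,T]$ and differentiable into it on $(0,T)$.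
\<close>

definition solves ::
    "(real ^ 'n::finite) set \<Rightarrow> ('n field \<Rightarrow> 'n field \<Rightarrow> real) \<Rightarrow> (real \<Rightarrow> real) \<Rightarrow> real \<Rightarrow>
      'n field set \<Rightarrow> (real \<Rightarrow> 'n field) \<Rightarrow> 'n field \<Rightarrow> 'n field \<Rightarrow>
      (real \<Rightarrow> 'n field) \<Rightarrow> (real \<Rightarrow> 'n field) \<Rightarrow> (real \<Rightarrow> 'n field) \<Rightarrow> bool" where
  "solves \<Omega> a K T W f w0 w1 u u' u'' \<longleftrightarrow>
     (\<forall>t\<in>{0..T}. u t \<in> W \<and> u' t \<in> H10 \<Omega> \<and>
        ((\<lambda>s. sobolev_norm \<Omega> 1 (\<lambda>x. (u s x - u t x) /\<^sub>R (s - t) - u' t x)) \<longlongrightarrow> 0)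
          (at t within {0..T}) \<and>
        ((\<lambda>s. l2norm \<Omega> (\<lambda>x. u' s x - u' t x)) \<longlongrightarrow> 0) (at t within {0..T})) \<and>
     (\<forall>t\<in>{0<..<T}. u'' t \<in> L2 \<Omega> \<and>
        ((\<lambda>s. l2norm \<Omega> (\<lambda>x. (u' s x - u' t x) /\<^sub>R (s - t) - u'' t x)) \<longlongrightarrow> 0) (at t)) \<and>
     ae_eq \<Omega> (u 0) w0 \<and> ae_eq \<Omega> (u' 0) w1 \<and>
     (\<forall>t\<in>{0<..<T}. f t \<in> L2 \<Omega> \<and> (\<forall>v\<in>W.
        l2inner \<Omega> (u'' t) v + a (u t) v - (LBINT s:{0..t}. K (t - s) * a (u s) v)
          = l2inner \<Omega> (f t) v))"

end

theory Submission
  imports Defs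
begin

text \<open>
  Write $\theta = u_h - \mathcal R_h u$ and $e = u_h - u$. Since $(\dot e(0),\psi)=0$ on the finite
  element space, integrating the error equation in time gives
  $(\dot e(s),\psi) = -\int_0^s \eta(s-t)\,a(\theta(t),\psi)\,dt$ with
  $\eta(x) = 1 - \int_0^x \mathcal K$. The function $\eta$ is nonnegative, nonincreasing and convex, hence
  of positive type (Polya), so taking $\psi=\theta(s)$ and integrating again yields
  $\int_0^\tau(\dot e,\theta)\le 0$ for every $\tau$. As
  $\frac12\frac{d}{dt}\|\theta\|^2 = (\dot e,\theta) - (\mathcal R_h\dot u-\dot u,\theta)$, choosing
  for $\tau$ a maximum point of $\|\theta\|$ bounds $\|\theta\|$ by
  $\|\theta(0)\| + 2\int_0^T\|\mathcal R_h\dot u-\dot u\|$.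
\<close>

subsection \<open>Semi-inner products on function spaces\<close>

text \<open>The test function is \<theta> rather than its time derivative because the bound is in
  L2: one integration in time lowers the inertia term to first order, and the discrete initial
  velocity \<open>P u1\<close> makes the constant of integration vanish, so no velocity error
  enters. Only the primitive of the kernel survives this integration; hence \<eta> is continuous and
  at least 1 - \<kappa> > 0 even when the kernel is singular at the origin. Positive type is
  obtained without Fourier analysis, from finite sums over uniform grids and a passage to Riemann
  integrals. The factor 2 is what remains when the quadratic inequality for the maximum is divided
  by the maximum. Two features of the encoding shape the rest. Fields are functions, not classes
  modulo null sets, so the inner products are only semidefinite, and one locale treats the L2
  product and the energy form alike. The Ritz projection is any map with the Galerkin property, so
  its compatibility with sums and time derivatives has to be recovered from that property in the
  energy seminorm.\<close>

locale form_space =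
  fixes S :: "('x \<Rightarrow> 'y::real_vector) set" and b :: "('x \<Rightarrow> 'y) \<Rightarrow> ('x \<Rightarrow> 'y) \<Rightarrow> real"
  assumes add_mem: "v \<in> S \<Longrightarrow> w \<in> S \<Longrightarrow> (\<lambda>x. v x + w x) \<in> S"
    and scale_mem: "v \<in> S \<Longrightarrow> (\<lambda>x. r *\<^sub>R v x) \<in> S"
    and sym: "v \<in> S \<Longrightarrow> w \<in> S \<Longrightarrow> b v w = b w v"
    and add_left: "v \<in> S \<Longrightarrow> w \<in> S \<Longrightarrow> z \<in> S \<Longrightarrow> b (\<lambda>x. v x + w x) z = b v z + b w z"
    and scale_left: "v \<in> S \<Longrightarrow> w \<in> S \<Longrightarrow> b (\<lambda>x. r *\<^sub>R v x) w = r * b v w"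
    and pos: "v \<in> S \<Longrightarrow> 0 \<le> b v v"
begin

text \<open>A seminorm only, since a nonzero field may vanish almost everywhere. On
  \<open>L2\<close> it becomes \<open>l2norm\<close>, on \<open>H10\<close> with the form
  \<open>a\<close> the energy seminorm.\<close>

definition nrm :: "('x \<Rightarrow> 'y) \<Rightarrow> real" where
  "nrm v = sqrt (b v v)"

lemma nrm_nonneg: "v \<in> S \<Longrightarrow> 0 \<le> nrm v"
  by (simp add: nrm_def pos)

lemma nrm_square: "v \<in> S \<Longrightarrow> (nrm v)\<^sup>2 = b v v"
  by (simp add: nrm_def pos)

lemma uminus_mem: "v \<in> S \<Longrightarrow> (\<lambda>x. - v x) \<in> S"
  using scale_mem[of v "-1"] by simp

lemma diff_mem: "v \<in> S \<Longrightarrow> w \<in> S \<Longrightarrow> (\<lambda>x. v x - w x) \<in> S"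
  using add_mem[OF _ uminus_mem, of v w] by simp

lemma add_right: "v \<in> S \<Longrightarrow> w \<in> S \<Longrightarrow> z \<in> S \<Longrightarrow> b z (\<lambda>x. v x + w x) = b z v + b z w"
  by (simp add: sym[of z] add_mem add_left)

lemma scale_right: "v \<in> S \<Longrightarrow> w \<in> S \<Longrightarrow> b w (\<lambda>x. r *\<^sub>R v x) = r * b w v"
  by (simp add: sym[of w] scale_mem scale_left)

lemma uminus_left: "v \<in> S \<Longrightarrow> w \<in> S \<Longrightarrow> b (\<lambda>x. - v x) w = - b v w"
  using scale_left[of v w "-1"] by simp

lemma diff_left: "v \<in> S \<Longrightarrow> w \<in> S \<Longrightarrow> z \<in> S \<Longrightarrow> b (\<lambda>x. v x - w x) z = b v z - b w z"
  using add_left[OF _ uminus_mem, of v w z] uminus_left[of w z] by simp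

lemma diff_right: "v \<in> S \<Longrightarrow> w \<in> S \<Longrightarrow> z \<in> S \<Longrightarrow> b z (\<lambda>x. v x - w x) = b z v - b z w"
  by (simp add: sym[of z] diff_mem diff_left)

lemmas bilinear = add_left add_right scale_left scale_right diff_left diff_right

lemmas closed = add_mem scale_mem diff_mem

text \<open>The discriminant argument. The case \<open>b w w = 0\<close> is separate because the
  form is only semidefinite: the quadratic in \<open>r\<close> is then affine and bounded below, so
  its slope vanishes.\<close>

lemma Cauchy_Schwarz:
  assumes v: "v \<in> S" and w: "w \<in> S"
  shows "\<bar>b v w\<bar> \<le> nrm v * nrm w"
proof -
  have quad: "0 \<le> b v v + 2 * r * b v w + r\<^sup>2 * b w w" for r
  proof -
    have "0 \<le> b (\<lambda>x. v x + r *\<^sub>R w x) (\<lambda>x. v x + r *\<^sub>R w x)"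
      using v w by (intro pos closed)
    also have "\<dots> = b v v + 2 * r * b v w + r\<^sup>2 * b w w"
      using v w by (simp add: bilinear closed sym[of w v] power2_eq_square algebra_simps)
    finally show ?thesis .
  qed
  have "(b v w)\<^sup>2 \<le> b v v * b w w"
  proof (cases "b w w = 0")
    case True
    have "b v w = 0"
    proof (rule ccontr)
      assume ne: "b v w \<noteq> 0"
      \<comment> \<open>At \<open>r = - (b v v + 1) / (2 * b v w)\<close> the affine function equals
        -1.\<close>
      show False
        using quad[of "- (b v v + 1) / (2 * b v w)"] ne True by (simp add: field_simps)
    qed
    then show ?thesis using v w by (simp add: True)
  next
    case False
    then have p: "b w w > 0" using pos[OF w] by simp
    have "0 \<le> (b v v + 2 * (- b v w / b w w) * b v w + (- b v w / b w w)\<^sup>2 * b w w) * b w w"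
      using quad[of "- b v w / b w w"] p by simp
    also have "\<dots> = b v v * b w w - (b v w)\<^sup>2"
      using p by (simp add: field_simps power2_eq_square)
    finally show ?thesis by simp
  qed
  then have "sqrt ((b v w)\<^sup>2) \<le> sqrt (b v v * b w w)" by (rule real_sqrt_le_mono)
  then show ?thesis by (simp add: nrm_def real_sqrt_mult)
qed

lemma nrm_scale: "v \<in> S \<Longrightarrow> nrm (\<lambda>x. r *\<^sub>R v x) = \<bar>r\<bar> * nrm v"
  unfolding nrm_def by (simp add: bilinear closed real_sqrt_mult flip: mult.assoc power2_eq_square)

lemma nrm_zero: "v \<in> S \<Longrightarrow> nrm (\<lambda>x. 0) = 0"
  using nrm_scale[of v 0] by simp

lemma nrm_triangle:
  assumes v: "v \<in> S" and w: "w \<in> S"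
  shows "nrm (\<lambda>x. v x + w x) \<le> nrm v + nrm w"
proof (rule power2_le_imp_le)
  have "(nrm (\<lambda>x. v x + w x))\<^sup>2 = (nrm v)\<^sup>2 + 2 * b v w + (nrm w)\<^sup>2"
    using v w by (simp add: nrm_square bilinear closed sym[of w v])
  also have "\<dots> \<le> (nrm v + nrm w)\<^sup>2"
    using Cauchy_Schwarz[OF v w] by (simp add: power2_sum)
  finally show "(nrm (\<lambda>x. v x + w x))\<^sup>2 \<le> (nrm v + nrm w)\<^sup>2" .
  show "0 \<le> nrm v + nrm w" using v w by (simp add: nrm_nonneg)
qed

lemma nrm_uminus: "v \<in> S \<Longrightarrow> nrm (\<lambda>x. - v x) = nrm v"
  using nrm_scale[of v "-1"] by simp

lemma nrm_diff_le:
  assumes v: "v \<in> S" and w: "w \<in> S"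
  shows "nrm (\<lambda>x. v x - w x) \<le> nrm v + nrm w"
  using nrm_triangle[OF v uminus_mem[OF w]] nrm_uminus[OF w] by simp

text \<open>The index set is nonempty because the empty sum is the zero function, which lies in
  \<open>S\<close> only if \<open>S\<close> has an element to scale.\<close>

lemma sum_mem:
  assumes "finite I" "I \<noteq> {}" "\<And>i. i \<in> I \<Longrightarrow> v i \<in> S"
  shows "(\<lambda>x. \<Sum>i\<in>I. v i x) \<in> S"
  using assms by (induction I rule: finite_ne_induct) (auto intro: add_mem)

lemma sum_left:
  assumes "finite I" "I \<noteq> {}" "\<And>i. i \<in> I \<Longrightarrow> v i \<in> S" "w \<in> S"
  shows "b (\<lambda>x. \<Sum>i\<in>I. v i x) w = (\<Sum>i\<in>I. b (v i) w)"
  using assms by (induction I rule: finite_ne_induct) (auto simp: add_left sum_mem)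

text \<open>The double sum is \<open>b z z\<close> for the sum \<open>z\<close> of the family. The
  fields are indexed rather than collected in a set, so repetitions are harmless.\<close>

lemma gram_sum_nonneg:
  assumes "finite I" "\<And>i. i \<in> I \<Longrightarrow> v i \<in> S"
  shows "0 \<le> (\<Sum>i\<in>I. \<Sum>j\<in>I. b (v i) (v j))"
proof (cases "I = {}")
  case False
  let ?z = "\<lambda>x. \<Sum>i\<in>I. v i x"
  have z: "?z \<in> S" using assms False by (intro sum_mem)
  have "(\<Sum>i\<in>I. \<Sum>j\<in>I. b (v i) (v j)) = (\<Sum>i\<in>I. \<Sum>j\<in>I. b (v j) (v i))"
    by (rule sum.swap)
  also have "\<dots> = (\<Sum>i\<in>I. b ?z (v i))"
    using assms False by (simp add: sum_left)
  also have "\<dots> = (\<Sum>i\<in>I. b (v i) ?z)"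
    using assms z by (intro sum.cong sym) auto
  also have "\<dots> = b ?z ?z"
    using assms False z by (simp add: sum_left)
  finally show ?thesis using pos[OF z] by simp
qed simp

section \<open>Limits and derivatives of a form along curves\<close>

lemma tendsto_form:
  assumes "eventually (\<lambda>s. v s \<in> S) F" "v0 \<in> S" "((\<lambda>s. nrm (\<lambda>x. v s x - v0 x)) \<longlongrightarrow> 0) F"
    and "eventually (\<lambda>s. w s \<in> S) F" "w0 \<in> S" "((\<lambda>s. nrm (\<lambda>x. w s x - w0 x)) \<longlongrightarrow> 0) F"
  shows "((\<lambda>s. b (v s) (w s)) \<longlongrightarrow> b v0 w0) F"
proof -
  let ?V = "\<lambda>s. nrm (\<lambda>x. v s x - v0 x)" and ?W = "\<lambda>s. nrm (\<lambda>x. w s x - w0 x)"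
  have "((\<lambda>s. b (v s) (w s) - b v0 w0) \<longlongrightarrow> 0) F"
  proof (rule Lim_null_comparison)
    show "((\<lambda>s. ?V s * ?W s + ?V s * nrm w0 + nrm v0 * ?W s) \<longlongrightarrow> 0) F"
      using assms(3,6) by (auto intro!: tendsto_eq_intros)
    show "eventually (\<lambda>s. norm (b (v s) (w s) - b v0 w0)
        \<le> ?V s * ?W s + ?V s * nrm w0 + nrm v0 * ?W s) F"
      using assms(1,4)
    proof eventually_elim
      case (elim s)
      let ?dv = "\<lambda>x. v s x - v0 x" and ?dw = "\<lambda>x. w s x - w0 x"
      have mem: "?dv \<in> S" "?dw \<in> S" using elim assms by (auto intro: diff_mem)
      \<comment> \<open>Expanding around the limits leaves only increments and fixed factors, so no
        bound on the moving arguments is required.\<close>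
      have "b (v s) (w s) - b v0 w0 = b ?dv ?dw + b ?dv w0 + b v0 ?dw"
        using elim assms(2,5) by (simp add: bilinear closed)
      then show ?case
        using Cauchy_Schwarz[OF mem] Cauchy_Schwarz[OF mem(1) assms(5)]
          Cauchy_Schwarz[OF assms(2) mem(2)] by simp
    qed
  qed
  then show ?thesis by (rule LIM_zero_cancel)
qed

text \<open>The increment is \<open>s - t\<close> times a field of bounded norm, namely the quotient
  error plus \<open>v'\<close>.\<close>

lemma quotient_imp_continuous:
  assumes "\<And>s. s \<in> I \<Longrightarrow> v s \<in> S" "t \<in> I" "v' \<in> S"
    and "((\<lambda>s. nrm (\<lambda>x. (v s x - v t x) /\<^sub>R (s - t) - v' x)) \<longlongrightarrow> 0) (at t within I)"
  shows "((\<lambda>s. nrm (\<lambda>x. v s x - v t x)) \<longlongrightarrow> 0) (at t within I)"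
proof (rule Lim_null_comparison)
  let ?q = "\<lambda>s x. (v s x - v t x) /\<^sub>R (s - t) - v' x"
  show "((\<lambda>s. \<bar>s - t\<bar> * (nrm (?q s) + nrm v')) \<longlongrightarrow> 0) (at t within I)"
    by (rule tendsto_eq_intros assms(4) refl | simp)+
  have "eventually (\<lambda>s. s \<in> I \<and> s \<noteq> t) (at t within I)"
    by (simp add: eventually_at_filter)
  then show "eventually (\<lambda>s. norm (nrm (\<lambda>x. v s x - v t x)) \<le> \<bar>s - t\<bar> * (nrm (?q s) + nrm v'))
      (at t within I)"
  proof eventually_elim
    case (elim s)
    have q: "?q s \<in> S" using elim assms by (intro closed) auto
    have eq: "(\<lambda>x. v s x - v t x) = (\<lambda>x. (s - t) *\<^sub>R (?q s x + v' x))"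
      using elim by (simp add: fun_eq_iff)
    have "nrm (\<lambda>x. v s x - v t x) = \<bar>s - t\<bar> * nrm (\<lambda>x. ?q s x + v' x)"
      unfolding eq using q assms(3) by (intro nrm_scale add_mem)
    also have "\<dots> \<le> \<bar>s - t\<bar> * (nrm (?q s) + nrm v')"
      using q assms(3) by (intro mult_left_mono nrm_triangle) auto
    finally show ?case using elim assms by (simp add: nrm_nonneg diff_mem)
  qed
qed

text \<open>Half of a product rule: one argument is differenced while the other moves. A constant
  \<open>w\<close> gives the derivative of a linear functional of \<open>v\<close>;
  \<open>w = v\<close> gives one of the two terms in the derivative of the square.\<close>

lemma quotient_form:
  assumes v: "\<And>s. s \<in> I \<Longrightarrow> v s \<in> S" "t \<in> I" "v' \<in> S"
    and qv: "((\<lambda>s. nrm (\<lambda>x. (v s x - v t x) /\<^sub>R (s - t) - v' x)) \<longlongrightarrow> 0) (at t within I)"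
    and w: "\<And>s. s \<in> I \<Longrightarrow> w s \<in> S" "w0 \<in> S"
      "((\<lambda>s. nrm (\<lambda>x. w s x - w0 x)) \<longlongrightarrow> 0) (at t within I)"
  shows "((\<lambda>s. (b (v s) (w s) - b (v t) (w s)) / (s - t)) \<longlongrightarrow> b v' w0) (at t within I)"
proof (rule Lim_transform_eventually)
  have ev: "eventually (\<lambda>s. s \<in> I) (at t within I)"
    by (simp add: eventually_at_filter)
  show "((\<lambda>s. b (\<lambda>x. (v s x - v t x) /\<^sub>R (s - t)) (w s)) \<longlongrightarrow> b v' w0) (at t within I)"
    using v w ev qv by (intro tendsto_form eventually_mono[OF ev] closed) auto
  show "eventually (\<lambda>s. b (\<lambda>x. (v s x - v t x) /\<^sub>R (s - t)) (w s)
      = (b (v s) (w s) - b (v t) (w s)) / (s - t)) (at t within I)"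
    using ev by eventually_elim (use v w in \<open>simp add: bilinear closed divide_inverse mult.commute\<close>)
qed

lemma has_derivative_form_left:
  assumes v: "\<And>s. s \<in> I \<Longrightarrow> v s \<in> S" "t \<in> I" "v' \<in> S" "w \<in> S"
    and qv: "((\<lambda>s. nrm (\<lambda>x. (v s x - v t x) /\<^sub>R (s - t) - v' x)) \<longlongrightarrow> 0) (at t within I)"
  shows "((\<lambda>s. b (v s) w) has_real_derivative b v' w) (at t within I)"
  unfolding has_field_derivative_iff
  by (intro quotient_form[where w = "\<lambda>_. w"] v qv) (auto simp: nrm_zero[OF \<open>w \<in> S\<close>])

lemma has_derivative_square:
  assumes v: "\<And>s. s \<in> I \<Longrightarrow> v s \<in> S" "t \<in> I" "v' \<in> S"
    and qv: "((\<lambda>s. nrm (\<lambda>x. (v s x - v t x) /\<^sub>R (s - t) - v' x)) \<longlongrightarrow> 0) (at t within I)"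
  shows "((\<lambda>s. b (v s) (v s)) has_real_derivative 2 * b v' (v t)) (at t within I)"
  unfolding has_field_derivative_iff
proof (rule Lim_transform_eventually)
  note cont = quotient_imp_continuous[OF assms]
  \<comment> \<open>The difference of squares telescopes through \<open>b (v t) (v s)\<close>, which
    by symmetry equals \<open>b (v s) (v t)\<close>; each of the two quotients tends to
    \<open>b v' (v t)\<close>.\<close>
  let ?q = "\<lambda>w s. (b (v s) w - b (v t) w) / (s - t)"
  have "((\<lambda>s. ?q (v s) s + ?q (v t) s) \<longlongrightarrow> b v' (v t) + b v' (v t)) (at t within I)"
    using has_derivative_form_left[OF v v(1)[OF v(2)] qv]
    by (intro tendsto_add quotient_form v qv cont) (auto simp: nrm_zero[OF v(1)[OF v(2)]] v has_field_derivative_iff)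
  then show "((\<lambda>s. ?q (v s) s + ?q (v t) s) \<longlongrightarrow> 2 * b v' (v t)) (at t within I)" by simp
  have "eventually (\<lambda>s. s \<in> I) (at t within I)"
    by (simp add: eventually_at_filter)
  then show "eventually (\<lambda>s. ?q (v s) s + ?q (v t) s
      = (b (v s) (v s) - b (v t) (v t)) / (s - t)) (at t within I)"
  proof eventually_elim
    case (elim s)
    have "b (v t) (v s) = b (v s) (v t)" using elim v by (intro sym) auto
    then show ?case by (simp add: add_divide_distrib[symmetric])
  qed
qed

end

subsection \<open>Linear structure of the function spaces\<close>

lemma L2_inner_integrable:
  assumes "v \<in> L2 \<Omega>" "w \<in> L2 \<Omega>"
  shows "integrable (lebesgue_on \<Omega>) (\<lambda>x. v x \<bullet> w x)"
proof (rule Bochner_Integration.integrable_bound)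
  show "integrable (lebesgue_on \<Omega>) (\<lambda>x. (norm (v x))\<^sup>2 + (norm (w x))\<^sup>2)"
    using assms by (auto simp: L2_def)
  show "(\<lambda>x. v x \<bullet> w x) \<in> borel_measurable (lebesgue_on \<Omega>)"
    using assms by (auto simp: L2_def)
  have "\<bar>v x \<bullet> w x\<bar> \<le> (norm (v x))\<^sup>2 + (norm (w x))\<^sup>2" for x
  proof -
    have "\<bar>v x \<bullet> w x\<bar> \<le> norm (v x) * norm (w x)" by (rule Cauchy_Schwarz_ineq2)
    also have "\<dots> \<le> 2 * norm (v x) * norm (w x)" by simp
    also have "\<dots> \<le> (norm (v x))\<^sup>2 + (norm (w x))\<^sup>2" by (rule sum_squares_bound)
    finally show ?thesis .
  qed
  then show "AE x in lebesgue_on \<Omega>. norm (v x \<bullet> w x) \<le> norm ((norm (v x))\<^sup>2 + (norm (w x))\<^sup>2)"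
    by (auto simp: abs_of_nonneg)
qed

lemma L2_add:
  assumes "v \<in> L2 \<Omega>" "w \<in> L2 \<Omega>"
  shows "(\<lambda>x. v x + w x) \<in> L2 \<Omega>"
proof -
  have "(\<lambda>x. (norm (v x + w x))\<^sup>2) = (\<lambda>x. (norm (v x))\<^sup>2 + 2 * (v x \<bullet> w x) + (norm (w x))\<^sup>2)"
    by (simp add: fun_eq_iff power2_norm_eq_inner inner_add inner_commute)
  then show ?thesis
    using assms L2_inner_integrable[OF assms] by (auto simp: L2_def)
qed

lemma L2_scale: "v \<in> L2 \<Omega> \<Longrightarrow> (\<lambda>x. r *\<^sub>R v x) \<in> L2 \<Omega>"
  by (auto simp: L2_def power_mult_distrib)

lemma form_space_L2:
  fixes \<Omega> :: "(real ^ 'n::finite) set"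
  shows "form_space (L2 \<Omega>) (l2inner \<Omega>)"
proof
  fix v w z :: "'n field" and r :: real
  show "l2inner \<Omega> v w = l2inner \<Omega> w v"
    by (simp add: l2inner_def inner_commute)
  assume mem: "v \<in> L2 \<Omega>" "w \<in> L2 \<Omega>"
  show "l2inner \<Omega> (\<lambda>x. r *\<^sub>R v x) w = r * l2inner \<Omega> v w"
    by (simp add: l2inner_def)
  assume z: "z \<in> L2 \<Omega>"
  show "l2inner \<Omega> (\<lambda>x. v x + w x) z = l2inner \<Omega> v z + l2inner \<Omega> w z"
    by (simp add: l2inner_def inner_add_left Bochner_Integration.integral_add
        L2_inner_integrable mem z)
qed (auto simp: L2_add L2_scale l2inner_def)

interpretation L2: form_space "L2 \<Omega>" "l2inner \<Omega>"
  rewrites "form_space.nrm (l2inner \<Omega>) = l2norm \<Omega>"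
proof -
  show "form_space (L2 \<Omega>) (l2inner \<Omega>)" by (rule form_space_L2)
  then interpret form_space "L2 \<Omega>" "l2inner \<Omega>" .
  show "nrm = l2norm \<Omega>" by (simp add: fun_eq_iff nrm_def l2norm_def)
qed

text \<open>No membership in \<open>L2\<close> is required: the integrand is nonnegative, and the
  integral of a non-integrable function is 0 by convention.\<close>

lemma l2norm_nonneg: "0 \<le> l2norm \<Omega> v"
  by (simp add: l2norm_def l2inner_def)

lemma l2inner_cong_ae:
  assumes "ae_eq \<Omega> v v'" "ae_eq \<Omega> w w'"
    and "v \<in> L2 \<Omega>" "v' \<in> L2 \<Omega>" "w \<in> L2 \<Omega>" "w' \<in> L2 \<Omega>"
  shows "l2inner \<Omega> v w = l2inner \<Omega> v' w'"
  unfolding l2inner_def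
proof (rule integral_cong_AE)
  show "AE x in lebesgue_on \<Omega>. v x \<bullet> w x = v' x \<bullet> w' x"
    using assms(1,2) unfolding ae_eq_def by eventually_elim simp
qed (use assms in \<open>auto simp: L2_def\<close>)

section \<open>Test functions and their derivatives\<close>

lemma frechet_derivative_plus:
  assumes "f differentiable (at x)" "g differentiable (at x)"
  shows "frechet_derivative (\<lambda>x. f x + g x) (at x)
    = (\<lambda>h. frechet_derivative f (at x) h + frechet_derivative g (at x) h)"
  using assms unfolding frechet_derivative_works
  by (intro frechet_derivative_at[symmetric] has_derivative_add)

lemma pderivs_add:
  assumes "\<And>js x. pderivs js \<phi> differentiable (at x)" "\<And>js x. pderivs js \<psi> differentiable (at x)"
  shows "pderivs js (\<lambda>x. \<phi> x + \<psi> x) = (\<lambda>x. pderivs js \<phi> x + pderivs js \<psi> x)"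
  using assms by (induction js) (auto simp: frechet_derivative_plus)

lemma frechet_derivative_scaleR:
  fixes f :: "'a::real_normed_vector \<Rightarrow> 'b::real_normed_vector"
  assumes "f differentiable (at x)"
  shows "frechet_derivative (\<lambda>x. r *\<^sub>R f x) (at x) = (\<lambda>h. r *\<^sub>R frechet_derivative f (at x) h)"
  using assms unfolding frechet_derivative_works
  by (intro frechet_derivative_at[symmetric] has_derivative_scaleR_right)

lemma pderivs_scale:
  assumes "\<And>js x. pderivs js \<phi> differentiable (at x)"
  shows "pderivs js (\<lambda>x. r * \<phi> x) = (\<lambda>x. r * pderivs js \<phi> x)"
  using assms by (induction js) (auto simp: frechet_derivative_scaleR[where 'b = real, unfolded real_scaleR_def])

lemma compact_closure_subset:
  fixes X :: "'a::euclidean_space set"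
  assumes "compact C" "C \<subseteq> \<Omega>" "X \<subseteq> C"
  shows "compact (closure X)" "closure X \<subseteq> \<Omega>"
proof -
  show "compact (closure X)"
    using assms bounded_subset[OF compact_imp_bounded] by (auto simp: compact_closure)
  show "closure X \<subseteq> \<Omega>"
    using closure_minimal[OF assms(3) compact_imp_closed[OF assms(1)]] assms(2) by blast
qed

lemma test_function_add:
  assumes "test_function \<Omega> \<phi>" "test_function \<Omega> \<psi>"
  shows "test_function \<Omega> (\<lambda>x. \<phi> x + \<psi> x)"
proof -
  let ?C = "closure {x. \<phi> x \<noteq> 0} \<union> closure {x. \<psi> x \<noteq> 0}"
  have C: "compact ?C" "?C \<subseteq> \<Omega>" using assms by (auto simp: test_function_def)
  have "{x. \<phi> x + \<psi> x \<noteq> 0} \<subseteq> ?C"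
    using closure_subset[of "{x. \<phi> x \<noteq> 0}"] closure_subset[of "{x. \<psi> x \<noteq> 0}"] by force
  from compact_closure_subset[OF C this] show ?thesis
    using assms unfolding test_function_def by (simp add: pderivs_add)
qed

lemma test_function_scale:
  assumes "test_function \<Omega> \<phi>"
  shows "test_function \<Omega> (\<lambda>x. r * \<phi> x)"
proof -
  let ?C = "closure {x. \<phi> x \<noteq> 0}"
  have C: "compact ?C" "?C \<subseteq> \<Omega>" using assms by (auto simp: test_function_def)
  have "{x. r * \<phi> x \<noteq> 0} \<subseteq> ?C"
    using closure_subset[of "{x. \<phi> x \<noteq> 0}"] by force
  from compact_closure_subset[OF C this] show ?thesis
    using assms unfolding test_function_def by (simp add: pderivs_scale)
qed

text \<open>The complement of the closed support is open, so the induction hypothesis holds on a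
  neighbourhood and the next derivative is that of the zero function.\<close>

lemma pderivs_eq_0:
  assumes "x \<notin> closure {x. \<phi> x \<noteq> 0}"
  shows "pderivs js \<phi> x = 0"
  using assms
proof (induction js arbitrary: x)
  case Nil
  then have "x \<notin> {x. \<phi> x \<noteq> 0}"
    using subsetD[OF closure_subset[of "{x. \<phi> x \<noteq> 0}"], of x] by argo
  then show ?case by simp
next
  case (Cons j js)
  have "(pderivs js \<phi> has_derivative (\<lambda>h. 0)) (at x)"
  proof (rule has_derivative_transform_within_open[of "\<lambda>_. 0"])
    show "open (- closure {x. \<phi> x \<noteq> 0})" by (intro open_Compl closed_closure)
    show "0 = pderivs js \<phi> y" if "y \<in> - closure {x. \<phi> x \<noteq> 0}" for y
      using Cons.IH[of y] that by simp
  qed (use Cons.prems in simp_all)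
  from frechet_derivative_at[OF this] show ?case by (simp add: fun_eq_iff)
qed

lemma test_function_pderivs:
  assumes "test_function \<Omega> \<phi>"
  shows "\<exists>C B. compact C \<and> C \<subseteq> \<Omega> \<and> (\<forall>x. x \<notin> C \<longrightarrow> pderivs js \<phi> x = 0) \<and>
    (\<forall>x. \<bar>pderivs js \<phi> x\<bar> \<le> B) \<and> continuous_on UNIV (pderivs js \<phi>)"
proof -
  let ?C = "closure {x. \<phi> x \<noteq> 0}"
  have cont: "continuous_on UNIV (pderivs js \<phi>)"
    using assms unfolding test_function_def
    by (intro continuous_at_imp_continuous_on) (auto intro: differentiable_imp_continuous_within)
  have C: "compact ?C" "?C \<subseteq> \<Omega>" using assms by (auto simp: test_function_def)
  then have "bounded (pderivs js \<phi> ` ?C)"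
    by (intro compact_imp_bounded compact_continuous_image continuous_on_subset[OF cont]) auto
  then obtain B where "\<forall>x\<in>?C. \<bar>pderivs js \<phi> x\<bar> \<le> B"
    unfolding bounded_iff by auto
  then have "\<bar>pderivs js \<phi> x\<bar> \<le> \<bar>B\<bar>" for x
    using pderivs_eq_0[of x \<phi> js] by (cases "x \<in> ?C") force+
  then show ?thesis using C cont pderivs_eq_0[of _ \<phi> js] by blast
qed

lemma test_function_square_integrable:
  fixes \<Omega> :: "(real ^ 'n::finite) set"
  assumes \<phi>: "test_function \<Omega> \<phi>" and \<Omega>: "open \<Omega>"
  shows "pderivs js \<phi> \<in> borel_measurable (lebesgue_on \<Omega>)"
    and "integrable (lebesgue_on \<Omega>) (\<lambda>x. (pderivs js \<phi> x)\<^sup>2)"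
proof -
  obtain C B where C: "compact C" "C \<subseteq> \<Omega>" "\<And>x. x \<notin> C \<Longrightarrow> pderivs js \<phi> x = 0"
    and B: "\<And>x. \<bar>pderivs js \<phi> x\<bar> \<le> B" and cont: "continuous_on UNIV (pderivs js \<phi>)"
    using test_function_pderivs[OF \<phi>] by meson
  have [measurable]: "\<Omega> \<in> sets lebesgue" using \<Omega> by auto
  show meas: "pderivs js \<phi> \<in> borel_measurable (lebesgue_on \<Omega>)"
    by (intro continuous_imp_measurable_on_sets_lebesgue continuous_on_subset[OF cont]) auto
  show "integrable (lebesgue_on \<Omega>) (\<lambda>x. (pderivs js \<phi> x)\<^sup>2)"
  proof (rule Bochner_Integration.integrable_bound)
    have "emeasure (lebesgue_on \<Omega>) C < \<infinity>" "C \<in> sets (lebesgue_on \<Omega>)"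
      using C(2) fmeasurableD[OF lmeasurable_compact[OF C(1)]] fmeasurableD2[OF lmeasurable_compact[OF C(1)]]
      by (auto simp: emeasure_restrict_space sets_restrict_space_iff less_top)
    then show "integrable (lebesgue_on \<Omega>) (\<lambda>x. B\<^sup>2 * indicator C x)"
      by (intro integrable_mult_right integrable_real_indicator)
    show "(\<lambda>x. (pderivs js \<phi> x)\<^sup>2) \<in> borel_measurable (lebesgue_on \<Omega>)"
      using meas by measurable
    have "(pderivs js \<phi> x)\<^sup>2 \<le> B\<^sup>2 * indicator C x" for x
      using C(3)[of x] power_mono[OF B[of x], of 2] by (cases "x \<in> C") auto
    then show "AE x in lebesgue_on \<Omega>. norm ((pderivs js \<phi> x)\<^sup>2) \<le> norm (B\<^sup>2 * indicat_real C x)"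
      by (auto simp: abs_mult)
  qed
qed

text \<open>Additivity of weak derivatives splits an integral, which requires both parts to be
  integrable. Here the product is dominated by the sum of two squares.\<close>

lemma test_function_scaleR_integrable:
  assumes \<phi>: "test_function \<Omega> \<phi>" and \<Omega>: "open \<Omega>" and v: "v \<in> L2 \<Omega>"
  shows "integrable (lebesgue_on \<Omega>) (\<lambda>x. pderivs js \<phi> x *\<^sub>R v x)"
proof (rule Bochner_Integration.integrable_bound)
  note sq = test_function_square_integrable[OF \<phi> \<Omega>, of js]
  show "integrable (lebesgue_on \<Omega>) (\<lambda>x. (pderivs js \<phi> x)\<^sup>2 + (norm (v x))\<^sup>2)"
    using v sq by (auto simp: L2_def)
  show "(\<lambda>x. pderivs js \<phi> x *\<^sub>R v x) \<in> borel_measurable (lebesgue_on \<Omega>)"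
    using v sq by (auto simp: L2_def)
  have "\<bar>p\<bar> * q \<le> p\<^sup>2 + q\<^sup>2" if "0 \<le> q" for p q :: real
  proof -
    have "\<bar>p\<bar> * q \<le> 2 * \<bar>p\<bar> * q" using that by simp
    also have "\<dots> \<le> p\<^sup>2 + q\<^sup>2" using sum_squares_bound[of "\<bar>p\<bar>" q] by simp
    finally show ?thesis .
  qed
  then show "AE x in lebesgue_on \<Omega>. norm (pderivs js \<phi> x *\<^sub>R v x)
      \<le> norm ((pderivs js \<phi> x)\<^sup>2 + (norm (v x))\<^sup>2)"
    by (auto simp: abs_of_nonneg)
qed

section \<open>Weak derivatives and Sobolev spaces\<close>

lemma has_weak_deriv_add:
  assumes \<Omega>: "open \<Omega>" and mem: "v \<in> L2 \<Omega>" "w \<in> L2 \<Omega>" "g \<in> L2 \<Omega>" "k \<in> L2 \<Omega>"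
    and "has_weak_deriv \<Omega> js v g" "has_weak_deriv \<Omega> js w k"
  shows "has_weak_deriv \<Omega> js (\<lambda>x. v x + w x) (\<lambda>x. g x + k x)"
  unfolding has_weak_deriv_def
proof (intro allI impI)
  fix \<phi> assume \<phi>: "test_function \<Omega> \<phi>"
  note int = test_function_scaleR_integrable[OF \<phi> \<Omega>]
  show "(\<integral>x. pderivs js \<phi> x *\<^sub>R (v x + w x) \<partial>lebesgue_on \<Omega>) =
       (-1) ^ length js *\<^sub>R (\<integral>x. \<phi> x *\<^sub>R (g x + k x) \<partial>lebesgue_on \<Omega>)"
    using assms(6,7) \<phi> int[OF mem(1), of js] int[OF mem(2), of js] int[OF mem(3), of "[]"] int[OF mem(4), of "[]"]
    by (simp add: has_weak_deriv_def scaleR_add_right)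
qed

text \<open>In contrast to sums, a scalar leaves the integral whether or not the integrand is
  integrable, hence no \<open>L2\<close> hypotheses.\<close>

lemma has_weak_deriv_scale:
  assumes "has_weak_deriv \<Omega> js v g"
  shows "has_weak_deriv \<Omega> js (\<lambda>x. r *\<^sub>R v x) (\<lambda>x. r *\<^sub>R g x)"
proof -
  have "(\<integral>x. q x *\<^sub>R r *\<^sub>R f x \<partial>M) = r *\<^sub>R (\<integral>x. q x *\<^sub>R f x \<partial>M)" for q M and f :: "'a field"
    by (subst scaleR_left_commute) (rule integral_scaleR_right)
  then show ?thesis
    using assms by (simp add: has_weak_deriv_def del: scaleR_scaleR) (simp add: mult.commute)
qed

lemma sobolev_add:
  assumes \<Omega>: "open \<Omega>" and v: "v \<in> sobolev \<Omega> s" and w: "w \<in> sobolev \<Omega> s"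
  shows "(\<lambda>x. v x + w x) \<in> sobolev \<Omega> s"
proof -
  have L: "v \<in> L2 \<Omega>" "w \<in> L2 \<Omega>" using v w by (auto simp: sobolev_def)
  have "\<exists>g\<in>L2 \<Omega>. has_weak_deriv \<Omega> js (\<lambda>x. v x + w x) g" if js: "length js \<le> s" for js
  proof -
    obtain g k where g: "g \<in> L2 \<Omega>" "has_weak_deriv \<Omega> js v g"
      and k: "k \<in> L2 \<Omega>" "has_weak_deriv \<Omega> js w k"
      using v w js unfolding sobolev_def by blast
    show ?thesis
      using has_weak_deriv_add[OF \<Omega> L g(1) k(1) g(2) k(2)] L2_add[OF g(1) k(1)] by (rule bexI)
  qed
  then show ?thesis using L by (simp add: sobolev_def L2_add)
qed

lemma sobolev_scale:
  assumes v: "v \<in> sobolev \<Omega> s"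
  shows "(\<lambda>x. r *\<^sub>R v x) \<in> sobolev \<Omega> s"
proof -
  have L: "v \<in> L2 \<Omega>" using v by (auto simp: sobolev_def)
  have "\<exists>g\<in>L2 \<Omega>. has_weak_deriv \<Omega> js (\<lambda>x. r *\<^sub>R v x) g" if js: "length js \<le> s" for js
  proof -
    obtain g where g: "g \<in> L2 \<Omega>" "has_weak_deriv \<Omega> js v g"
      using v js unfolding sobolev_def by blast
    show ?thesis
      using has_weak_deriv_scale[OF g(2)] L2_scale[OF g(1)] by (rule bexI)
  qed
  then show ?thesis using L by (simp add: sobolev_def L2_scale)
qed

section \<open>Fields in the closure of the test fields\<close>

lemma test_field_differentiable:
  fixes \<phi> :: "'n::finite field"
  assumes "\<And>k. test_function \<Omega> (\<lambda>x. \<phi> x $ k)"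
  shows "\<phi> differentiable (at x)"
    and "frechet_derivative \<phi> (at x) h $ k = frechet_derivative (\<lambda>x. \<phi> x $ k) (at x) h"
proof -
  have "(\<lambda>x. \<phi> x $ k) differentiable (at x)" for k
    using assms[of k] unfolding test_function_def by (metis pderivs.simps(1))
  then show d: "\<phi> differentiable (at x)"
    by (subst differentiable_componentwise_within) (auto simp: Basis_vec_def inner_axis)
  have "((\<lambda>x. \<phi> x $ k) has_derivative (\<lambda>h. frechet_derivative \<phi> (at x) h $ k)) (at x)"
    using d by (intro bounded_linear.has_derivative[OF bounded_linear_vec_nth])
      (simp add: frechet_derivative_works)
  then show "frechet_derivative \<phi> (at x) h $ k = frechet_derivative (\<lambda>x. \<phi> x $ k) (at x) h"
    by (simp add: frechet_derivative_at[symmetric])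
qed

text \<open>Serves twice: with \<open>js = []\<close> for the test fields themselves and with
  \<open>js = [j]\<close> for their classical partial derivatives.\<close>

lemma test_field_L2:
  fixes \<phi> :: "'n::finite field"
  assumes \<Omega>: "open \<Omega>" and \<phi>: "\<And>k. test_function \<Omega> (\<psi> k)"
    and eq: "\<And>x k. v x $ k = pderivs js (\<psi> k) x"
  shows "v \<in> L2 \<Omega>"
proof -
  note sq = test_function_square_integrable[OF \<phi> \<Omega>, of js]
  have v: "v = (\<lambda>x. \<Sum>k\<in>UNIV. pderivs js (\<psi> k) x *\<^sub>R axis k 1)"
    by (simp add: fun_eq_iff vec_eq_iff eq axis_def if_distrib[of "\<lambda>x. _ * x"] cong: if_cong)
  have "v \<in> borel_measurable (lebesgue_on \<Omega>)"
    unfolding v using sq(1) by measurable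
  moreover have "(\<lambda>x. (norm (v x))\<^sup>2) = (\<lambda>x. \<Sum>k\<in>UNIV. (pderivs js (\<psi> k) x)\<^sup>2)"
    unfolding power2_norm_eq_inner by (simp add: inner_vec_def eq power2_eq_square)
  ultimately show ?thesis using sq(2) by (simp add: L2_def)
qed

text \<open>Approximating fields and gradients are added termwise; since \<open>H10\<close>
  quantifies the gradient existentially, the sum of the two given gradients is admissible. The
  triangle inequality is available on \<open>L2\<close> only, so the test fields and their
  derivatives are placed there beforehand.\<close>

lemma H10_add:
  fixes v w :: "'n::finite field"
  assumes \<Omega>: "open \<Omega>" and v: "v \<in> H10 \<Omega>" and w: "w \<in> H10 \<Omega>"
  shows "(\<lambda>x. v x + w x) \<in> H10 \<Omega>"
proof -
  let ?D = "\<lambda>\<phi> j x. frechet_derivative \<phi> (at x) (axis j 1)"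
  obtain \<phi> :: "nat \<Rightarrow> 'n field" and G where \<phi>: "\<And>n k. test_function \<Omega> (\<lambda>x. \<phi> n x $ k)"
    "(\<lambda>n. l2norm \<Omega> (\<lambda>x. \<phi> n x - v x)) \<longlonglongrightarrow> 0"
    "\<And>j. G j \<in> L2 \<Omega>" "\<And>j. has_weak_deriv \<Omega> [j] v (G j)"
    "\<And>j. (\<lambda>n. l2norm \<Omega> (\<lambda>x. ?D (\<phi> n) j x - G j x)) \<longlonglongrightarrow> 0"
    using v unfolding H10_def by blast
  obtain \<psi> :: "nat \<Rightarrow> 'n field" and J where \<psi>: "\<And>n k. test_function \<Omega> (\<lambda>x. \<psi> n x $ k)"
    "(\<lambda>n. l2norm \<Omega> (\<lambda>x. \<psi> n x - w x)) \<longlonglongrightarrow> 0"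
    "\<And>j. J j \<in> L2 \<Omega>" "\<And>j. has_weak_deriv \<Omega> [j] w (J j)"
    "\<And>j. (\<lambda>n. l2norm \<Omega> (\<lambda>x. ?D (\<psi> n) j x - J j x)) \<longlonglongrightarrow> 0"
    using w unfolding H10_def by blast
  have vw: "v \<in> sobolev \<Omega> 1" "w \<in> sobolev \<Omega> 1" using v w by (auto simp: H10_def)
  then have vwL: "v \<in> L2 \<Omega>" "w \<in> L2 \<Omega>" by (auto simp: sobolev_def)
  note d\<phi> = test_field_differentiable[OF \<phi>(1)] and d\<psi> = test_field_differentiable[OF \<psi>(1)]
  have L: "\<phi> n \<in> L2 \<Omega>" "\<psi> n \<in> L2 \<Omega>" "?D (\<phi> n) j \<in> L2 \<Omega>" "?D (\<psi> n) j \<in> L2 \<Omega>" for n j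
    by (rule test_field_L2[OF \<Omega> \<phi>(1)[of n], of _ "[]"], simp)
      (rule test_field_L2[OF \<Omega> \<psi>(1)[of n], of _ "[]"], simp,
       rule test_field_L2[OF \<Omega> \<phi>(1)[of n], of _ "[j]"], simp add: d\<phi>(2),
       rule test_field_L2[OF \<Omega> \<psi>(1)[of n], of _ "[j]"], simp add: d\<psi>(2))
  have conv: "(\<lambda>n. l2norm \<Omega> (\<lambda>x. p n x + q n x - (f x + g x))) \<longlonglongrightarrow> 0"
    if "\<And>n. p n \<in> L2 \<Omega>" "\<And>n. q n \<in> L2 \<Omega>" "f \<in> L2 \<Omega>" "g \<in> L2 \<Omega>"
      "(\<lambda>n. l2norm \<Omega> (\<lambda>x. p n x - f x)) \<longlonglongrightarrow> 0" "(\<lambda>n. l2norm \<Omega> (\<lambda>x. q n x - g x)) \<longlonglongrightarrow> 0"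
    for p q and f g :: "'n field"
  proof (rule tendsto_sandwich[OF _ _ tendsto_const])
    show "(\<lambda>n. l2norm \<Omega> (\<lambda>x. p n x - f x) + l2norm \<Omega> (\<lambda>x. q n x - g x)) \<longlonglongrightarrow> 0"
      using tendsto_add[OF that(5,6)] by simp
    have "l2norm \<Omega> (\<lambda>x. (p n x - f x) + (q n x - g x))
        \<le> l2norm \<Omega> (\<lambda>x. p n x - f x) + l2norm \<Omega> (\<lambda>x. q n x - g x)" for n
      using that by (intro L2.nrm_triangle L2.diff_mem)
    then show "\<forall>\<^sub>F n in sequentially. l2norm \<Omega> (\<lambda>x. p n x + q n x - (f x + g x))
        \<le> l2norm \<Omega> (\<lambda>x. p n x - f x) + l2norm \<Omega> (\<lambda>x. q n x - g x)"
      by (simp add: add_diff_add)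
  qed (simp add: l2norm_nonneg)
  show ?thesis
    unfolding H10_def mem_Collect_eq
  proof (intro conjI exI[of _ "\<lambda>n x. \<phi> n x + \<psi> n x"] exI[of _ "\<lambda>j x. G j x + J j x"] allI)
    show "(\<lambda>x. v x + w x) \<in> sobolev \<Omega> 1" using vw by (rule sobolev_add[OF \<Omega>])
    show "test_function \<Omega> (\<lambda>x. (\<phi> n x + \<psi> n x) $ k)" for n k
      using test_function_add[OF \<phi>(1) \<psi>(1)] by simp
    show "(\<lambda>n. l2norm \<Omega> (\<lambda>x. \<phi> n x + \<psi> n x - (v x + w x))) \<longlonglongrightarrow> 0"
      by (intro conv L vwL \<phi> \<psi>)
    fix j
    show "(\<lambda>x. G j x + J j x) \<in> L2 \<Omega>" by (intro L2_add \<phi> \<psi>)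
    show "has_weak_deriv \<Omega> [j] (\<lambda>x. v x + w x) (\<lambda>x. G j x + J j x)"
      by (intro has_weak_deriv_add \<Omega> vwL \<phi> \<psi>)
    show "(\<lambda>n. l2norm \<Omega> (\<lambda>x. ?D (\<lambda>x. \<phi> n x + \<psi> n x) j x - (G j x + J j x))) \<longlonglongrightarrow> 0"
      unfolding frechet_derivative_plus[OF d\<phi>(1) d\<psi>(1)]
      by (intro conv L \<phi> \<psi>)
  qed
qed

lemma H10_scale:
  fixes v :: "'n::finite field"
  assumes \<Omega>: "open \<Omega>" and v: "v \<in> H10 \<Omega>"
  shows "(\<lambda>x. r *\<^sub>R v x) \<in> H10 \<Omega>"
proof -
  let ?D = "\<lambda>\<phi> j x. frechet_derivative \<phi> (at x) (axis j 1)"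
  obtain \<phi> :: "nat \<Rightarrow> 'n field" and G where \<phi>: "\<And>n k. test_function \<Omega> (\<lambda>x. \<phi> n x $ k)"
    "(\<lambda>n. l2norm \<Omega> (\<lambda>x. \<phi> n x - v x)) \<longlonglongrightarrow> 0"
    "\<And>j. G j \<in> L2 \<Omega>" "\<And>j. has_weak_deriv \<Omega> [j] v (G j)"
    "\<And>j. (\<lambda>n. l2norm \<Omega> (\<lambda>x. ?D (\<phi> n) j x - G j x)) \<longlonglongrightarrow> 0"
    using v unfolding H10_def by blast
  have vs: "v \<in> sobolev \<Omega> 1" using v by (auto simp: H10_def)
  then have vL: "v \<in> L2 \<Omega>" by (auto simp: sobolev_def)
  note d\<phi> = test_field_differentiable[OF \<phi>(1)]
  have L: "\<phi> n \<in> L2 \<Omega>" "?D (\<phi> n) j \<in> L2 \<Omega>" for n j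
    by (rule test_field_L2[OF \<Omega> \<phi>(1)[of n], of _ "[]"], simp)
      (rule test_field_L2[OF \<Omega> \<phi>(1)[of n], of _ "[j]"], simp add: d\<phi>(2))
  have conv: "(\<lambda>n. l2norm \<Omega> (\<lambda>x. r *\<^sub>R p n x - r *\<^sub>R f x)) \<longlonglongrightarrow> 0"
    if "\<And>n. p n \<in> L2 \<Omega>" "f \<in> L2 \<Omega>" "(\<lambda>n. l2norm \<Omega> (\<lambda>x. p n x - f x)) \<longlonglongrightarrow> 0"
    for p and f :: "'n field"
    using tendsto_mult_right_zero[OF that(3), of "\<bar>r\<bar>"] that
    by (simp add: L2.nrm_scale L2.diff_mem flip: scaleR_diff_right)
  show ?thesis
    unfolding H10_def mem_Collect_eq
  proof (intro conjI exI[of _ "\<lambda>n x. r *\<^sub>R \<phi> n x"] exI[of _ "\<lambda>j x. r *\<^sub>R G j x"] allI)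
    show "(\<lambda>x. r *\<^sub>R v x) \<in> sobolev \<Omega> 1" using vs by (rule sobolev_scale)
    show "test_function \<Omega> (\<lambda>x. (r *\<^sub>R \<phi> n x) $ k)" for n k
      using test_function_scale[OF \<phi>(1)] by simp
    show "(\<lambda>n. l2norm \<Omega> (\<lambda>x. r *\<^sub>R \<phi> n x - r *\<^sub>R v x)) \<longlonglongrightarrow> 0"
      by (intro conv L vL \<phi>)
    fix j
    show "(\<lambda>x. r *\<^sub>R G j x) \<in> L2 \<Omega>" by (intro L2_scale \<phi>)
    show "has_weak_deriv \<Omega> [j] (\<lambda>x. r *\<^sub>R v x) (\<lambda>x. r *\<^sub>R G j x)"
      by (intro has_weak_deriv_scale \<phi>)
    show "(\<lambda>n. l2norm \<Omega> (\<lambda>x. ?D (\<lambda>x. r *\<^sub>R \<phi> n x) j x - r *\<^sub>R G j x)) \<longlonglongrightarrow> 0"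
      unfolding frechet_derivative_scaleR[OF d\<phi>(1)]
      by (intro conv L \<phi>)
  qed
qed

lemma H10_imp_L2: "v \<in> H10 \<Omega> \<Longrightarrow> v \<in> L2 \<Omega>"
  by (simp add: H10_def sobolev_def)

section \<open>Finite element functions, norms and mesh size\<close>

lemma fe_space_add:
  assumes "open \<Omega>" "v \<in> fe_space \<Omega> l \<T>" "w \<in> fe_space \<Omega> l \<T>"
  shows "(\<lambda>x. v x + w x) \<in> fe_space \<Omega> l \<T>"
proof -
  have "polynomial_on S k (\<lambda>x. v x + w x)" if poly: "polynomial_on S k v" "polynomial_on S k w" for S k
  proof -
    obtain c d where cd: "\<forall>x\<in>S. v x = (\<Sum>\<alpha> | sum \<alpha> UNIV \<le> k. (\<Prod>i\<in>UNIV. x $ i ^ \<alpha> i) *\<^sub>R c \<alpha>)"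
      "\<forall>x\<in>S. w x = (\<Sum>\<alpha> | sum \<alpha> UNIV \<le> k. (\<Prod>i\<in>UNIV. x $ i ^ \<alpha> i) *\<^sub>R d \<alpha>)"
      using poly unfolding polynomial_on_def by blast
    show ?thesis
      unfolding polynomial_on_def
      by (rule exI[of _ "\<lambda>\<alpha>. c \<alpha> + d \<alpha>"]) (simp add: cd scaleR_add_right sum.distrib)
  qed
  then show ?thesis using assms by (auto simp: fe_space_def H10_add intro!: continuous_intros)
qed

lemma fe_space_scale:
  assumes "open \<Omega>" "v \<in> fe_space \<Omega> l \<T>"
  shows "(\<lambda>x. r *\<^sub>R v x) \<in> fe_space \<Omega> l \<T>"
proof -
  have "polynomial_on S k (\<lambda>x. r *\<^sub>R v x)" if poly: "polynomial_on S k v" for S k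
  proof -
    obtain c where c: "\<forall>x\<in>S. v x = (\<Sum>\<alpha> | sum \<alpha> UNIV \<le> k. (\<Prod>i\<in>UNIV. x $ i ^ \<alpha> i) *\<^sub>R c \<alpha>)"
      using poly unfolding polynomial_on_def by blast
    show ?thesis
      unfolding polynomial_on_def
      by (rule exI[of _ "\<lambda>\<alpha>. r *\<^sub>R c \<alpha>"]) (simp add: c scaleR_sum_right mult.commute)
  qed
  then show ?thesis using assms by (auto simp: fe_space_def H10_scale intro!: continuous_intros)
qed

text \<open>Holds for every field, because \<open>weak_deriv\<close> at the empty list is the field
  itself and not a choice among weak derivatives.\<close>

lemma l2norm_le_sobolev_norm: "l2norm \<Omega> v \<le> sobolev_norm \<Omega> s v"
proof -
  have fin: "finite {js :: 'a list. length js \<le> s}"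
    using finite_lists_length_le[of "UNIV :: 'a set" s] by simp
  have "(l2norm \<Omega> (weak_deriv \<Omega> [] v))\<^sup>2 \<le> (\<Sum>js | length js \<le> s. (l2norm \<Omega> (weak_deriv \<Omega> js v))\<^sup>2)"
    by (rule member_le_sum[OF _ _ fin]) auto
  then show ?thesis
    unfolding sobolev_norm_def by (intro real_le_rsqrt) (simp add: weak_deriv_def)
qed

lemma sobolev_norm_nonneg: "0 \<le> sobolev_norm \<Omega> s v"
  by (rule order.trans[OF l2norm_nonneg l2norm_le_sobolev_norm])

text \<open>\<open>Max\<close> is informative only on a nonempty finite set; a nonempty domain
  forces the covering to contain a simplex.\<close>

lemma mesh_size_nonneg:
  assumes \<T>: "triangulation_of \<Omega> \<T>" and \<Omega>: "\<Omega> \<noteq> {}"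
  shows "0 \<le> mesh_size \<T>"
proof -
  have fin: "finite \<T>" and simp: "\<And>S. S \<in> \<T> \<Longrightarrow> int CARD('a) simplex S" and cover: "\<Union>\<T> = closure \<Omega>"
    using \<T> by (auto simp: triangulation_of_def triangulation_def)
  obtain S where S: "S \<in> \<T>" using cover \<Omega> closure_subset[of \<Omega>] by blast
  have "0 \<le> diameter S"
    using simp[OF S] by (intro diameter_ge_0 compact_imp_bounded compact_simplex)
  also have "\<dots> \<le> mesh_size \<T>" unfolding mesh_size_def using fin S by (intro Max_ge) auto
  finally show ?thesis .
qed

text \<open>
  \<^const>\<open>sobolev_norm\<close> rests on a choice of weak derivatives, so that it does not obviously vanish on
  null functions. The energy form does, because null functions lie in the domain of the operator.
\<close>

lemma null_mem_op_domain:
  assumes "z \<in> H10 \<Omega>" "ae_eq \<Omega> z (\<lambda>x. 0)"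
  shows "z \<in> op_domain \<Omega>"
proof -
  have z: "z \<in> L2 \<Omega>" using assms(1) by (rule H10_imp_L2)
  have 0: "(\<lambda>x. 0) \<in> L2 \<Omega>" by (simp add: L2_def)
  have "has_weak_deriv \<Omega> js z (\<lambda>x. 0)" for js
    unfolding has_weak_deriv_def
  proof (intro allI impI)
    fix \<phi>
    have "AE x in lebesgue_on \<Omega>. pderivs js \<phi> x *\<^sub>R z x = 0"
      using assms(2) unfolding ae_eq_def by eventually_elim simp
    then show "(\<integral>x. pderivs js \<phi> x *\<^sub>R z x \<partial>lebesgue_on \<Omega>) =
       (-1) ^ length js *\<^sub>R (\<integral>x. \<phi> x *\<^sub>R 0 \<partial>lebesgue_on \<Omega>)"
      by (simp add: integral_eq_zero_AE)
  qed
  then show ?thesis using assms z 0 by (auto simp: op_domain_def sobolev_def)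
qed

section \<open>The energy form as a semi-inner product\<close>

lemma form_space_energy:
  assumes \<Omega>: "open \<Omega>" and a: "energy_form \<Omega> A a"
  shows "form_space (H10 \<Omega>) a"
proof
  show "(\<lambda>x. v x + w x) \<in> H10 \<Omega>" if "v \<in> H10 \<Omega>" "w \<in> H10 \<Omega>" for v w
    using \<Omega> that by (rule H10_add)
  show "(\<lambda>x. r *\<^sub>R v x) \<in> H10 \<Omega>" if "v \<in> H10 \<Omega>" for r v
    using \<Omega> that by (rule H10_scale)
  show "a v w = a w v" if "v \<in> H10 \<Omega>" "w \<in> H10 \<Omega>" for v w
    using a that unfolding energy_form_def by blast
  show "a (\<lambda>x. v x + w x) z = a v z + a w z" if "v \<in> H10 \<Omega>" "w \<in> H10 \<Omega>" "z \<in> H10 \<Omega>" for v w z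
    using a that unfolding energy_form_def by blast
  show "a (\<lambda>x. r *\<^sub>R v x) w = r * a v w" if "v \<in> H10 \<Omega>" "w \<in> H10 \<Omega>" for r v w
    using a that unfolding energy_form_def by blast
  obtain m where "m > 0" "\<And>v. v \<in> H10 \<Omega> \<Longrightarrow> m * (sobolev_norm \<Omega> 1 v)\<^sup>2 \<le> a v v"
    using a unfolding energy_form_def by blast
  then show "0 \<le> a v v" if "v \<in> H10 \<Omega>" for v
    using that order.trans[of 0 "m * (sobolev_norm \<Omega> 1 v)\<^sup>2" "a v v"] by simp
qed

lemma energy_null:
  assumes a: "energy_form \<Omega> A a" and A: "self_adjoint \<Omega> (op_domain \<Omega>) A"
    and z: "z \<in> H10 \<Omega>" "ae_eq \<Omega> z (\<lambda>x. 0)"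
  shows "a z z = 0"
proof -
  have D: "z \<in> op_domain \<Omega>" using z by (rule null_mem_op_domain)
  have "a z z = l2inner \<Omega> (A z) z" using a D by (auto simp: energy_form_def)
  also have "\<dots> = l2inner \<Omega> (A z) (\<lambda>x. 0)"
  proof (rule l2inner_cong_ae)
    show "A z \<in> L2 \<Omega>" "A z \<in> L2 \<Omega>" using A D unfolding self_adjoint_def by blast+
    show "ae_eq \<Omega> (A z) (A z)" by (simp add: ae_eq_def)
    show "(\<lambda>x. 0) \<in> L2 \<Omega>" by (simp add: L2_def)
  qed (use z in \<open>simp_all add: H10_imp_L2\<close>)
  finally show ?thesis by (simp add: l2inner_def)
qed

subsection \<open>Positivity of convex convolution kernels\<close>

text \<open>
  A convex, nonincreasing, nonnegative sequence is a nonnegative combination of a constant and of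
  triangles $(m-n)_+$. The number $(m-|i-j|)_+$ counts the windows of length $m$ containing both $i$
  and $j$, so a triangle turns $\sum_{i,j}$ into a sum of Gram sums over windows.
\<close>

lemma convex_seq_expansion:
  fixes c :: "nat \<Rightarrow> real"
  assumes "n \<le> M"
  shows "c n = c M + real (M - n) * (c M - c (Suc M))
    + (\<Sum>q<M. real (q + 1 - n) * (c q - 2 * c (Suc q) + c (Suc (Suc q))))"
  using assms
proof (induction M rule: dec_induct)
  case base
  then show ?case by simp
next
  case (step M)
  have "real (Suc M - n) = real (M - n) + 1" "real (M + 1 - n) = real (M - n) + 1"
    using step.hyps by auto
  then show ?case using step.IH by (simp add: algebra_simps)
qed

text \<open>A window is named by the point \<open>k\<close> just past its right end, so it contains
  \<open>i\<close> iff \<open>i < k \<le> i + m\<close>. The range \<open>k \<le> N + m\<close>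
  misses no window, and truncated subtraction supplies the positive part.\<close>

lemma card_common_windows:
  fixes i j m N :: nat
  assumes "i < N" "j < N"
  shows "(\<Sum>k\<le>N + m. if i < k \<and> k \<le> i + m \<and> j < k \<and> k \<le> j + m then 1 else (0::real))
    = real (m - nat \<bar>int i - int j\<bar>)"
proof -
  have "{k. k \<le> N + m \<and> i < k \<and> k \<le> i + m \<and> j < k \<and> k \<le> j + m} = {max i j<..min i j + m}"
    using assms by auto
  then show ?thesis
    by (simp add: sum.If_cases Int_def)
qed

text \<open>For fixed \<open>k\<close> the condition on \<open>(i, j)\<close> is a product of one
  condition on each index, which leaves a square sum over one window. Windows are clipped at both
  ends of \<open>{..<N}\<close>, hence the hypothesis on arbitrary subsets.\<close>

lemma triangle_toeplitz_nonneg: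
  fixes g :: "nat \<Rightarrow> nat \<Rightarrow> real"
  assumes "\<And>I. I \<subseteq> {..<N} \<Longrightarrow> 0 \<le> (\<Sum>i\<in>I. \<Sum>j\<in>I. g i j)"
  shows "0 \<le> (\<Sum>i<N. \<Sum>j<N. real (m - nat \<bar>int i - int j\<bar>) * g i j)"
proof -
  let ?I = "\<lambda>k. {i. i < N \<and> i < k \<and> k \<le> i + m}"
  have eq: "{..<N} \<inter> {i. i < k \<and> k \<le> i + m} = ?I k" for k by auto
  have "(\<Sum>i<N. \<Sum>j<N. real (m - nat \<bar>int i - int j\<bar>) * g i j)
    = (\<Sum>i<N. \<Sum>j<N. \<Sum>k\<le>N + m.
        (if i < k \<and> k \<le> i + m \<and> j < k \<and> k \<le> j + m then g i j else 0))"
    by (intro sum.cong refl)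
      (simp add: card_common_windows[symmetric] sum_distrib_right if_distrib[of "\<lambda>x. x * _"] cong: if_cong)
  also have "\<dots> = (\<Sum>k\<le>N + m. \<Sum>i<N. \<Sum>j<N.
        (if i < k \<and> k \<le> i + m \<and> j < k \<and> k \<le> j + m then g i j else 0))"
    by (subst sum.swap[of _ "{..<N}" "{..N + m}"], subst sum.swap[of _ "{..<N}" "{..N + m}"]) simp
  also have "\<dots> = (\<Sum>k\<le>N + m. \<Sum>i<N. if i < k \<and> k \<le> i + m then
        (\<Sum>j<N. if j < k \<and> k \<le> j + m then g i j else 0) else 0)"
    by (intro sum.cong refl) (auto intro!: sum.neutral)
  also have "\<dots> = (\<Sum>k\<le>N + m. \<Sum>i\<in>?I k. \<Sum>j\<in>?I k. g i j)"
    by (simp add: sum.If_cases eq)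
  also have "\<dots> \<ge> 0"
    by (intro sum_nonneg assms) auto
  finally show ?thesis .
qed

text \<open>The expansion at \<open>M = N\<close> covers all distances \<open>|i - j|\<close> that
  occur. Its coefficients are nonnegative: the value \<open>c N\<close>, the final decrement by
  monotonicity, the second differences by convexity.\<close>

lemma convex_toeplitz_nonneg:
  fixes g :: "nat \<Rightarrow> nat \<Rightarrow> real" and c :: "nat \<Rightarrow> real"
  assumes g: "\<And>I. I \<subseteq> {..<N} \<Longrightarrow> 0 \<le> (\<Sum>i\<in>I. \<Sum>j\<in>I. g i j)"
    and c: "\<And>n. 0 \<le> c n" "\<And>n. c (Suc n) \<le> c n"
      "\<And>n. 0 \<le> c n - 2 * c (Suc n) + c (Suc (Suc n))"
  shows "0 \<le> (\<Sum>i<N. \<Sum>j<N. c (nat \<bar>int i - int j\<bar>) * g i j)"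
proof -
  let ?d = "\<lambda>i j. nat \<bar>int i - int j\<bar>"
  let ?S = "\<lambda>m. \<Sum>i<N. \<Sum>j<N. real (m - ?d i j) * g i j"
  let ?D = "\<lambda>q. c q - 2 * c (Suc q) + c (Suc (Suc q))"
  have "c (?d i j) * g i j = c N * g i j + (c N - c (Suc N)) * (real (N - ?d i j) * g i j)
     + (\<Sum>q<N. ?D q * (real (q + 1 - ?d i j) * g i j))" if "i < N" "j < N" for i j
    using that
    by (subst convex_seq_expansion[of "?d i j" N c])
      (auto simp: distrib_left sum_distrib_left mult_ac)
  then have "(\<Sum>i<N. \<Sum>j<N. c (?d i j) * g i j) = c N * (\<Sum>i<N. \<Sum>j<N. g i j)
     + (c N - c (Suc N)) * ?S N
     + (\<Sum>i<N. \<Sum>j<N. \<Sum>q<N. ?D q * (real (q + 1 - ?d i j) * g i j))"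
    by (simp add: sum.distrib sum_distrib_left)
  also have "(\<Sum>i<N. \<Sum>j<N. \<Sum>q<N. ?D q * (real (q + 1 - ?d i j) * g i j))
     = (\<Sum>q<N. \<Sum>i<N. \<Sum>j<N. ?D q * (real (q + 1 - ?d i j) * g i j))"
    by (rule trans[OF sum.cong[OF refl sum.swap] sum.swap])
  also have "\<dots> = (\<Sum>q<N. ?D q * ?S (q + 1))"
    by (simp add: sum_distrib_left)
  finally have eq: "(\<Sum>i<N. \<Sum>j<N. c (?d i j) * g i j) = c N * (\<Sum>i<N. \<Sum>j<N. g i j)
     + (c N - c (Suc N)) * ?S N + (\<Sum>q<N. ?D q * ?S (q + 1))" .
  have "0 \<le> ?S m" for m by (rule triangle_toeplitz_nonneg[OF g])
  moreover have "0 \<le> (\<Sum>i<N. \<Sum>j<N. g i j)" by (rule g) simp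
  moreover have "0 \<le> c N - c (Suc N)" using c(2)[of N] by simp
  ultimately show ?thesis
    unfolding eq using c(1)[of N] c(3)
    by (intro add_nonneg_nonneg[OF add_nonneg_nonneg] mult_nonneg_nonneg[of "c N"]
        mult_nonneg_nonneg[of "c N - c (Suc N)"] sum_nonneg[of _ "\<lambda>q. ?D q * ?S (q + 1)"]
        mult_nonneg_nonneg[of "?D _"])
qed

section \<open>From grid sums to iterated integrals\<close>

lemma integral_ge_grid_sum:
  fixes f :: "real \<Rightarrow> real"
  assumes "f integrable_on {0..real n * d}" "0 \<le> d"
    and "\<And>i x. i < n \<Longrightarrow> x \<in> {real i * d..real (Suc i) * d} \<Longrightarrow> m i \<le> f x"
  shows "d * (\<Sum>i<n. m i) \<le> integral {0..real n * d} f"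
  using assms
proof (induction n)
  case (Suc n)
  have nd: "0 \<le> real n * d" "real n * d \<le> real (Suc n) * d"
    using Suc.prems(2) by (auto intro: mult_right_mono)
  have int: "f integrable_on {0..real n * d}" "f integrable_on {real n * d..real (Suc n) * d}"
    by (rule integrable_on_subinterval[OF Suc.prems(1)]; use nd in \<open>simp only: atLeastatMost_subset_iff\<close>; simp)+
  have "d * m n = integral {real n * d..real (Suc n) * d} (\<lambda>_. m n)"
    using Suc.prems(2) by (simp add: algebra_simps)
  also have "\<dots> \<le> integral {real n * d..real (Suc n) * d} f"
    using Suc.prems int by (intro integral_le) auto
  finally have "d * (\<Sum>i<Suc n. m i)
      \<le> integral {0..real n * d} f + integral {real n * d..real (Suc n) * d} f"
    using Suc int by (simp add: distrib_left)
  also have "\<dots> = integral {0..real (Suc n) * d} f"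
    using Suc.prems by (intro Henstock_Kurzweil_Integration.integral_combine) (auto intro: mult_right_mono)
  finally show ?case .
qed simp

text \<open>By uniform continuity the integral falls short of the nonnegative Riemann sum, taken at
  the lower corners of the cells, by at most \<epsilon> times the area of the square.\<close>

lemma square_integral_nonneg:
  fixes H :: "real \<Rightarrow> real \<Rightarrow> real"
  assumes cont: "continuous_on ({0..\<tau>} \<times> {0..\<tau>}) (\<lambda>(t, s). H t s)" and \<tau>: "0 \<le> \<tau>"
    and grid: "\<And>n d. 0 \<le> d \<Longrightarrow> real n * d = \<tau> \<Longrightarrow> 0 \<le> (\<Sum>i<n. \<Sum>j<n. H (real i * d) (real j * d))"
  shows "0 \<le> integral {0..\<tau>} (\<lambda>s. integral {0..\<tau>} (\<lambda>t. H s t))"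
proof (rule field_le_epsilon)
  fix e :: real assume e: "0 < e"
  \<comment> \<open>The added 1 keeps the quotient meaningful when
    \<open>\<tau> = 0\<close>.\<close>
  define \<epsilon> where "\<epsilon> = e / (\<tau>\<^sup>2 + 1)"
  have \<epsilon>: "0 < \<epsilon>" "\<tau>\<^sup>2 * \<epsilon> \<le> e"
    using e by (auto simp: \<epsilon>_def field_simps add_pos_nonneg)
  have "uniformly_continuous_on ({0..\<tau>} \<times> {0..\<tau>}) (\<lambda>(t, s). H t s)"
    by (intro compact_uniformly_continuous cont compact_Times) auto
  then obtain \<delta> where \<delta>: "\<delta> > 0" and
    uc: "\<And>p q. p \<in> {0..\<tau>} \<times> {0..\<tau>} \<Longrightarrow> q \<in> {0..\<tau>} \<times> {0..\<tau>} \<Longrightarrow> dist q p < \<delta> \<Longrightarrow>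
      dist (case q of (t, s) \<Rightarrow> H t s) (case p of (t, s) \<Rightarrow> H t s) < \<epsilon>"
    unfolding uniformly_continuous_on_def using \<epsilon>(1) by meson
  \<comment> \<open>The factor 2 allows for both coordinates moving by up to \<open>d\<close> within
    a cell.\<close>
  obtain n where n: "2 * \<tau> / \<delta> < real n" using reals_Archimedean2 by blast
  have n0: "n > 0" using n \<tau> \<delta> by (cases n) (auto simp: field_simps)
  define d where "d = \<tau> / real n"
  have d: "0 \<le> d" "real n * d = \<tau>" "2 * d < \<delta>"
    using n n0 \<tau> \<delta> by (auto simp: d_def field_simps)
  have grid_pt: "real i * d \<in> {0..\<tau>}" "{real i * d..real (Suc i) * d} \<subseteq> {0..\<tau>}" if "i < n" for i
  proof -
    have "real i * d \<le> real n * d" "real (Suc i) * d \<le> real n * d"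
      using that d(1) by (auto intro!: mult_right_mono)
    moreover have "0 \<le> real i * d" using d(1) by simp
    ultimately show "real i * d \<in> {0..\<tau>}" "{real i * d..real (Suc i) * d} \<subseteq> {0..\<tau>}"
      unfolding d(2) by auto
  qed
  have lower: "H (real i * d) (real j * d) - \<epsilon> \<le> H x y"
    if ij: "i < n" "j < n" and xy: "x \<in> {real i * d..real (Suc i) * d}" "y \<in> {real j * d..real (Suc j) * d}"
    for i j x y
  proof -
    have "dist (x, y) (real i * d, real j * d) \<le> \<bar>x - real i * d\<bar> + \<bar>y - real j * d\<bar>"
      unfolding dist_prod_def by (rule order.trans[OF sqrt_sum_squares_le_sum_abs]) (auto simp: dist_real_def)
    also have "\<dots> \<le> d + d" using xy by (auto simp: algebra_simps abs_if)
    also have "\<dots> < \<delta>" using d(3) by simp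
    finally have "dist (H x y) (H (real i * d) (real j * d)) < \<epsilon>"
      using uc[of "(real i * d, real j * d)" "(x, y)"] grid_pt ij xy by (auto simp: subset_iff)
    then show ?thesis by (auto simp: dist_real_def)
  qed
  have inner_cont: "continuous_on {0..\<tau>} (\<lambda>s. integral {0..\<tau>} (\<lambda>t. H s t))"
    using integral_continuous_on_param[of "{0..\<tau>}" 0 \<tau> H] cont by simp
  have slice: "continuous_on {0..\<tau>} (H s)" if "s \<in> {0..\<tau>}" for s
    using that
    by (auto intro!: continuous_on_compose2[OF cont, of "{0..\<tau>}" "\<lambda>t. (s, t)", simplified] continuous_intros)
  have "0 \<le> d * d * (\<Sum>i<n. \<Sum>j<n. H (real i * d) (real j * d))"
    using grid[OF d(1,2)] by simp
  also have "\<dots> = d * (\<Sum>i<n. d * (\<Sum>j<n. H (real i * d) (real j * d) - \<epsilon>)) + (real n * d)\<^sup>2 * \<epsilon>"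
    by (simp add: sum_subtractf sum_distrib_left algebra_simps power2_eq_square)
  also have "d * (\<Sum>i<n. d * (\<Sum>j<n. H (real i * d) (real j * d) - \<epsilon>))
      \<le> integral {0..real n * d} (\<lambda>s. integral {0..\<tau>} (\<lambda>t. H s t))"
  proof (rule integral_ge_grid_sum[OF _ d(1)])
    show "(\<lambda>s. integral {0..\<tau>} (\<lambda>t. H s t)) integrable_on {0..real n * d}"
      unfolding d(2) by (intro integrable_continuous_interval inner_cont)
    show "d * (\<Sum>j<n. H (real i * d) (real j * d) - \<epsilon>) \<le> integral {0..\<tau>} (\<lambda>t. H x t)"
      if "i < n" "x \<in> {real i * d..real (Suc i) * d}" for i x
      unfolding d(2)[symmetric]
      using grid_pt[OF that(1)] that d(1,2)
      by (intro integral_ge_grid_sum lower integrable_continuous_interval)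
        (auto simp: d(2) subset_iff intro!: slice)
  qed
  also have "(real n * d)\<^sup>2 * \<epsilon> \<le> e" using \<epsilon> d(2) by simp
  finally show "0 \<le> integral {0..\<tau>} (\<lambda>s. integral {0..\<tau>} (\<lambda>t. H s t)) + e"
    unfolding d(2) by simp
qed

text \<open>Fubini for \<open>H\<close> cut off to the closed triangle, which is compact, so the
  discontinuous cut-off is integrable. The integrability of both inner integrals, whose limits vary,
  comes from the same application.\<close>

lemma triangle_integral_swap:
  fixes H :: "real \<Rightarrow> real \<Rightarrow> real"
  assumes cont: "continuous_on ({0..\<tau>} \<times> {0..\<tau>}) (\<lambda>(t, s). H t s)"
  shows "integral {0..\<tau>} (\<lambda>s. integral {0..s} (\<lambda>t. H t s))
    = integral {0..\<tau>} (\<lambda>t. integral {t..\<tau>} (\<lambda>s. H t s))"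
    and "(\<lambda>s. integral {0..s} (\<lambda>t. H t s)) integrable_on {0..\<tau>}"
    and "(\<lambda>t. integral {t..\<tau>} (\<lambda>s. H t s)) integrable_on {0..\<tau>}"
proof -
  let ?Q = "{p. 0 \<le> fst p \<and> fst p \<le> snd p \<and> snd p \<le> \<tau>}"
  define F where "F = (\<lambda>t s. indicator ?Q (t, s) *\<^sub>R H t s)"
  have "?Q \<subseteq> {0..\<tau>} \<times> {0..\<tau>}" by auto
  then have "bounded ?Q" by (rule bounded_subset[rotated]) (intro bounded_Times bounded_closed_interval)
  moreover have "closed ?Q"
    by (intro closed_Collect_conj closed_Collect_le continuous_intros)
  ultimately have "compact ?Q" by (simp add: compact_eq_bounded_closed)
  moreover have "continuous_on ?Q (\<lambda>(t, s). H t s)"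
    by (rule continuous_on_subset[OF cont]) auto
  ultimately have "integrable lborel (\<lambda>x. indicator ?Q x *\<^sub>R (case x of (t, s) \<Rightarrow> H t s))"
    by (rule borel_integrable_compact)
  then have int: "integrable (lborel \<Otimes>\<^sub>M lborel) (case_prod F)"
    by (simp add: F_def lborel_prod case_prod_beta')
  have slice: "continuous_on A (\<lambda>t. H t s)" "continuous_on A (\<lambda>t. H s t)"
    if "A \<subseteq> {0..\<tau>}" "s \<in> {0..\<tau>}" for s A
    using that
    by (auto intro!: continuous_on_compose2[OF cont, of A "\<lambda>t. (t, s)", simplified]
        continuous_on_compose2[OF cont, of A "\<lambda>t. (s, t)", simplified] continuous_intros)
  have inner: "(\<integral>x. indicator {a..b} x *\<^sub>R f x \<partial>lborel) = integral {a..b} f"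
    if "continuous_on {a..b} f" for a b and f :: "real \<Rightarrow> real"
    using set_borel_integral_eq_integral(2)[OF borel_integrable_atLeastAtMost'[OF that]]
    by (simp add: set_lebesgue_integral_def)
  have 1: "(\<integral>t. F t s \<partial>lborel) = (if s \<in> {0..\<tau>} then integral {0..s} (\<lambda>t. H t s) else 0)" for s
  proof (cases "s \<in> {0..\<tau>}")
    case True
    then have "(\<integral>t. F t s \<partial>lborel) = (\<integral>t. indicator {0..s} t *\<^sub>R H t s \<partial>lborel)"
      unfolding F_def by (intro Bochner_Integration.integral_cong refl) (auto simp: indicator_def)
    then show ?thesis using True by (simp add: inner[unfolded real_scaleR_def] slice)
  next
    case False
    then have "(\<lambda>t. F t s) = (\<lambda>t. 0)" by (auto simp: F_def indicator_def)
    then show ?thesis unfolding if_not_P[OF False] by simp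
  qed
  have 2: "(\<integral>s. F t s \<partial>lborel) = (if t \<in> {0..\<tau>} then integral {t..\<tau>} (\<lambda>s. H t s) else 0)" for t
  proof (cases "t \<in> {0..\<tau>}")
    case True
    then have "(\<integral>s. F t s \<partial>lborel) = (\<integral>s. indicator {t..\<tau>} s *\<^sub>R H t s \<partial>lborel)"
      unfolding F_def by (intro Bochner_Integration.integral_cong refl) (auto simp: indicator_def)
    then show ?thesis using True by (simp add: inner[unfolded real_scaleR_def] slice)
  next
    case False
    then have "(\<lambda>s. F t s) = (\<lambda>t. 0)" by (auto simp: F_def indicator_def)
    then show ?thesis unfolding if_not_P[OF False] by simp
  qed
  note i1 = has_integral_integral_lborel[OF lborel_pair.integrable_snd[OF int], unfolded 1 has_integral_restrict_UNIV]
  note i2 = has_integral_integral_lborel[OF lborel_pair.integrable_fst[OF int], unfolded 2 has_integral_restrict_UNIV]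
  show "(\<lambda>s. integral {0..s} (\<lambda>t. H t s)) integrable_on {0..\<tau>}"
    "(\<lambda>t. integral {t..\<tau>} (\<lambda>s. H t s)) integrable_on {0..\<tau>}"
    using i1 i2 by (auto simp: integrable_on_def)
  show "integral {0..\<tau>} (\<lambda>s. integral {0..s} (\<lambda>t. H t s))
    = integral {0..\<tau>} (\<lambda>t. integral {t..\<tau>} (\<lambda>s. H t s))"
    using integral_unique[OF i1] integral_unique[OF i2] lborel_pair.Fubini_integral[OF int]
    by (simp add: 1 2)
qed

text \<open>By symmetry the square integral is twice the triangle integral, and the former is a
  limit of the grid sums.\<close>

lemma triangle_integral_nonneg:
  fixes H :: "real \<Rightarrow> real \<Rightarrow> real"
  assumes cont: "continuous_on ({0..\<tau>} \<times> {0..\<tau>}) (\<lambda>(t, s). H t s)" and \<tau>: "0 \<le> \<tau>"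
    and sym: "\<And>s t. s \<in> {0..\<tau>} \<Longrightarrow> t \<in> {0..\<tau>} \<Longrightarrow> H s t = H t s"
    and grid: "\<And>n d. 0 \<le> d \<Longrightarrow> real n * d = \<tau> \<Longrightarrow> 0 \<le> (\<Sum>i<n. \<Sum>j<n. H (real i * d) (real j * d))"
  shows "0 \<le> integral {0..\<tau>} (\<lambda>s. integral {0..s} (\<lambda>t. H t s))"
proof -
  note tri = triangle_integral_swap[OF cont]
  let ?L = "\<lambda>s. integral {0..s} (\<lambda>t. H t s)" and ?U = "\<lambda>s. integral {s..\<tau>} (H s)"
  have "integral {0..\<tau>} (H s) = ?L s + ?U s" if s: "s \<in> {0..\<tau>}" for s
  proof -
    have "continuous_on {0..\<tau>} (H s)"
      using s
      by (auto intro!: continuous_on_compose2[OF cont, of "{0..\<tau>}" "\<lambda>t. (s, t)", simplified] continuous_intros)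
    then have "H s integrable_on {0..\<tau>}" by (rule integrable_continuous_interval)
    then have "integral {0..\<tau>} (H s) = integral {0..s} (H s) + ?U s"
      using s by (intro Henstock_Kurzweil_Integration.integral_combine[symmetric]) auto
    also have "integral {0..s} (H s) = ?L s"
      using s by (intro Henstock_Kurzweil_Integration.integral_cong sym) auto
    finally show ?thesis .
  qed
  then have "integral {0..\<tau>} (\<lambda>s. integral {0..\<tau>} (H s)) = integral {0..\<tau>} (\<lambda>s. ?L s + ?U s)"
    by (intro Henstock_Kurzweil_Integration.integral_cong) auto
  also have "\<dots> = integral {0..\<tau>} ?L + integral {0..\<tau>} ?U"
    using tri by (intro Henstock_Kurzweil_Integration.integral_add) auto
  also have "\<dots> = 2 * integral {0..\<tau>} ?L" using tri(1) by simp
  finally show ?thesis using square_integral_nonneg[OF cont \<tau> grid] by simp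
qed

subsection \<open>The damping kernel\<close>

text \<open>\<open>K\<close> is constrained on positive arguments only. The cut-off yields a kernel
  that is nonnegative and integrable on the whole line, and changes a convolution over
  \<open>{0..t}\<close> at a single point.\<close>

definition memory_part :: "(real \<Rightarrow> real) \<Rightarrow> real \<Rightarrow> real" where
  "memory_part K t = indicator {0<..} t * K t"

text \<open>The function \<eta> of the overview.\<close>

definition damp :: "(real \<Rightarrow> real) \<Rightarrow> real \<Rightarrow> real" where
  "damp K x = 1 - integral {0..x} (memory_part K)"

context
  fixes K :: "real \<Rightarrow> real"
  assumes K: "memory_kernel K"
begin

lemma memory_part_integrable: "integrable lborel (memory_part K)"
  and memory_part_integral_less: "integral\<^sup>L lborel (memory_part K) < 1"
  using K unfolding memory_kernel_def set_integrable_def set_lebesgue_integral_def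
  by (simp_all add: memory_part_def[abs_def])

lemma memory_part_nonneg: "0 \<le> memory_part K t"
  using K by (auto simp: memory_kernel_def memory_part_def indicator_def)

text \<open>The condition \<open>0 < s\<close> is essential, since the cut-off makes the value at
  the origin 0.\<close>

lemma memory_part_antimono:
  assumes "0 < s" "s \<le> t"
  shows "memory_part K t \<le> memory_part K s"
proof -
  have "K t \<le> K s"
  proof (rule DERIV_nonpos_imp_nonincreasing[OF assms(2)])
    fix x assume "s \<le> x"
    then have "0 < x" using assms(1) by simp
    then show "\<exists>y. (K has_real_derivative y) (at x) \<and> y \<le> 0"
      using K unfolding memory_kernel_def by blast
  qed
  then show ?thesis using assms by (simp add: memory_part_def)
qed

lemma memory_part_integrable_on: "memory_part K integrable_on {a..b}"
  using has_integral_integral_lborel[OF memory_part_integrable]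
  by (intro integrable_on_subinterval[of _ UNIV]) (auto simp: integrable_on_def)

text \<open>This is where the bound \<kappa> < 1 on the mass of the kernel enters.\<close>

lemma damp_nonneg: "0 \<le> damp K x"
proof -
  have "integral {0..x} (memory_part K) \<le> integral UNIV (memory_part K)"
    using has_integral_integral_lborel[OF memory_part_integrable]
    by (intro integral_subset_le memory_part_integrable_on) (auto simp: memory_part_nonneg)
  also have "\<dots> = integral\<^sup>L lborel (memory_part K)"
    by (rule integral_unique[OF has_integral_integral_lborel[OF memory_part_integrable]])
  finally show ?thesis using memory_part_integral_less by (simp add: damp_def)
qed

lemma damp_continuous: "continuous_on {0..b} (damp K)"
  unfolding damp_def
  by (intro continuous_intros indefinite_integral_continuous_1 memory_part_integrable_on)

lemma damp_diff:
  assumes "0 \<le> a" "0 \<le> d"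
  shows "damp K a - damp K (a + d) = integral {a..a + d} (memory_part K)"
  using Henstock_Kurzweil_Integration.integral_combine[of 0 a "a + d" "memory_part K"] assms
  by (simp add: damp_def memory_part_integrable_on)

lemma damp_antimono:
  assumes "0 \<le> a" "0 \<le> d"
  shows "damp K (a + d) \<le> damp K a"
  using damp_diff[OF assms] Henstock_Kurzweil_Integration.integral_nonneg[OF memory_part_integrable_on, of a "a + d"] memory_part_nonneg
  by simp

text \<open>The second difference compares the integrals of a nonincreasing function over two
  adjacent intervals of equal length.\<close>

lemma damp_convex:
  assumes "0 \<le> a" "0 \<le> d"
  shows "0 \<le> damp K a - 2 * damp K (a + d) + damp K (a + d + d)"
proof -
  have "integral {a + d..a + d + d} (memory_part K) \<le> integral {a..a + d} (memory_part K)"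
  proof (rule has_integral_le)
    \<comment> \<open>Passing to the open interval avoids the left end point, where the comparison
      of the two integrands may fail if \<open>a = 0\<close>.\<close>
    show "(memory_part K has_integral integral {a..a + d} (memory_part K)) {a<..<a + d}"
      unfolding has_integral_Icc_iff_Ioo[symmetric]
      by (rule integrable_integral[OF memory_part_integrable_on])
    have "((\<lambda>x. memory_part K (x + d)) has_integral integral {a + d..a + d + d} (memory_part K)) {a..a + d}"
      using has_integral_shift_real_ivl[OF integrable_integral[OF memory_part_integrable_on, of "a + d" "a + d + d"], of d]
      by (simp add: add.commute)
    then show "((\<lambda>x. memory_part K (x + d)) has_integral integral {a + d..a + d + d} (memory_part K)) {a<..<a + d}"
      unfolding has_integral_Icc_iff_Ioo[symmetric] .
    show "memory_part K (x + d) \<le> memory_part K x" if "x \<in> {a<..<a + d}" for x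
      using that assms by (intro memory_part_antimono) auto
  qed
  then show ?thesis using damp_diff[of a d] damp_diff[of "a + d" d] assms by simp
qed

text \<open>Polya's criterion in the time domain: on a uniform grid the weight depends on
  \<open>|i - j|\<close> alone, and equally spaced samples of a convex function have nonnegative
  second differences.\<close>

lemma damp_form_nonneg:
  fixes g :: "real \<Rightarrow> real \<Rightarrow> real"
  assumes cont: "continuous_on ({0..\<tau>} \<times> {0..\<tau>}) (\<lambda>(t, s). g t s)" and \<tau>: "0 \<le> \<tau>"
    and sym: "\<And>s t. s \<in> {0..\<tau>} \<Longrightarrow> t \<in> {0..\<tau>} \<Longrightarrow> g s t = g t s"
    and psd: "\<And>(I :: nat set) x. finite I \<Longrightarrow> x ` I \<subseteq> {0..\<tau>} \<Longrightarrow> 0 \<le> (\<Sum>i\<in>I. \<Sum>j\<in>I. g (x i) (x j))"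
  shows "0 \<le> integral {0..\<tau>} (\<lambda>s. integral {0..s} (\<lambda>t. damp K (s - t) * g t s))"
proof -
  \<comment> \<open>The absolute value extends the weight symmetrically from the triangle to the
    square, where Gram sums are available.\<close>
  let ?H = "\<lambda>t s. damp K \<bar>s - t\<bar> * g t s"
  have "0 \<le> integral {0..\<tau>} (\<lambda>s. integral {0..s} (\<lambda>t. ?H t s))"
  proof (rule triangle_integral_nonneg[OF _ \<tau>])
    have "continuous_on ({0..\<tau>} \<times> {0..\<tau>}) (\<lambda>p. damp K \<bar>snd p - fst p\<bar>)"
      by (intro continuous_on_compose2[OF damp_continuous[of \<tau>]] continuous_intros) auto
    then show "continuous_on ({0..\<tau>} \<times> {0..\<tau>}) (\<lambda>(t, s). ?H t s)"
      using continuous_on_mult[OF _ cont] by (simp add: case_prod_beta')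
    show "?H s t = ?H t s" if "s \<in> {0..\<tau>}" "t \<in> {0..\<tau>}" for s t
      using sym[OF that] by (simp add: abs_minus_commute)
    fix n :: nat and d :: real
    assume d: "0 \<le> d" "real n * d = \<tau>"
    have pt: "real i * d \<in> {0..\<tau>}" if "i < n" for i
      using d that mult_right_mono[of "real i" "real n" d] by auto
    have eq: "\<bar>real j * d - real i * d\<bar> = real (nat \<bar>int i - int j\<bar>) * d" for i j
      using d(1) by (simp add: abs_minus_commute abs_mult flip: left_diff_distrib)
    have c: "real (Suc m) * d = real m * d + d" "real (Suc (Suc m)) * d = real m * d + d + d" for m
      by (simp_all add: algebra_simps)
    have "0 \<le> (\<Sum>i<n. \<Sum>j<n. damp K (real (nat \<bar>int i - int j\<bar>) * d) * g (real i * d) (real j * d))"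
    proof (rule convex_toeplitz_nonneg[where c = "\<lambda>m. damp K (real m * d)"])
      show "0 \<le> (\<Sum>i\<in>I. \<Sum>j\<in>I. g (real i * d) (real j * d))" if "I \<subseteq> {..<n}" for I
        using that pt by (intro psd[of I "\<lambda>i. real i * d"] finite_subset[OF that]) auto
      fix m
      have m: "0 \<le> real m * d" using d(1) by simp
      show "0 \<le> damp K (real m * d)" by (rule damp_nonneg)
      show "damp K (real (Suc m) * d) \<le> damp K (real m * d)"
        unfolding c using m d(1) by (rule damp_antimono)
      show "0 \<le> damp K (real m * d) - 2 * damp K (real (Suc m) * d) + damp K (real (Suc (Suc m)) * d)"
        unfolding c using m d(1) by (rule damp_convex)
    qed
    then show "0 \<le> (\<Sum>i<n. \<Sum>j<n. ?H (real i * d) (real j * d))"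
      unfolding eq .
  qed
  also have "\<dots> = integral {0..\<tau>} (\<lambda>s. integral {0..s} (\<lambda>t. damp K (s - t) * g t s))"
    by (intro Henstock_Kurzweil_Integration.integral_cong) auto
  finally show ?thesis .
qed

section \<open>Integrals of the memory term\<close>

lemma memory_set_integrable:
  fixes p :: "real \<Rightarrow> real"
  assumes p: "continuous_on {0..t} p"
  shows "set_integrable lborel {0..t} (\<lambda>s. K (t - s) * p s)"
proof -
  let ?p = "\<lambda>s. indicator {0..t} s *\<^sub>R p s"
  have [measurable]: "?p \<in> borel_measurable borel"
    using borel_integrable_atLeastAtMost'[OF p] unfolding set_integrable_def by auto
  obtain B where B: "\<And>s. s \<in> {0..t} \<Longrightarrow> \<bar>p s\<bar> \<le> B"
    using compact_imp_bounded[OF compact_continuous_image[OF p compact_Icc]]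
    unfolding bounded_iff by fastforce
  have k: "integrable lborel (\<lambda>s. memory_part K (t - s))"
    using lborel_integrable_real_affine[OF memory_part_integrable, of "-1" t] by simp
  then have [measurable]: "(\<lambda>s. memory_part K (t - s)) \<in> borel_measurable borel" by auto
  have "integrable lborel (\<lambda>s. ?p s * memory_part K (t - s))"
  proof (rule Bochner_Integration.integrable_bound[OF integrable_mult_right[OF k, of "\<bar>B\<bar>"]])
    show "AE s in lborel. norm (?p s * memory_part K (t - s)) \<le> norm (\<bar>B\<bar> * memory_part K (t - s))"
      using B by (intro AE_I2) (force simp: abs_mult indicator_def memory_part_nonneg intro!: mult_right_mono)
  qed measurable
  then have "set_integrable lborel {0..t} (\<lambda>s. memory_part K (t - s) * p s)"
    unfolding set_integrable_def by (simp add: mult_ac)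
  \<comment> \<open>The end point \<open>s = t\<close> is removed because
    \<open>memory_part K\<close> and \<open>K\<close> may differ at 0, and restored afterwards as a
    null set.\<close>
  then have "set_integrable lborel {0..<t} (\<lambda>s. memory_part K (t - s) * p s)"
    by (rule set_integrable_subset) auto
  then have "set_integrable lborel {0..<t} (\<lambda>s. K (t - s) * p s)"
    by (rule iffD1[OF set_integrable_cong, rotated -1]) (auto simp: memory_part_def)
  then show ?thesis
    by (rule iffD1[OF set_integrable_discrete_difference[where X = "{t}"], rotated -1]) auto
qed

text \<open>After exchanging the integrals, \<open>p r\<close> is multiplied by the mass of the
  kernel on \<open>[0, s - r]\<close>, which is \<open>1 - damp K (s - r)\<close>. This is how the
  time integral of the memory term turns into the damping kernel.\<close>

lemma memory_double_integral:
  fixes p :: "real \<Rightarrow> real"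
  assumes p: "continuous_on {0..s} p"
  shows "((\<lambda>t. LBINT r:{0..t}. K (t - r) * p r) has_integral
    integral {0..s} (\<lambda>r. (1 - damp K (s - r)) * p r)) {0..s}"
proof -
  let ?p = "\<lambda>r. indicator {0..s} r *\<^sub>R p r"
  have p_int: "integrable lborel ?p"
    using borel_integrable_atLeastAtMost'[OF p] unfolding set_integrable_def .
  then have [measurable]: "?p \<in> borel_measurable borel" by auto
  have [measurable]: "memory_part K \<in> borel_measurable borel"
    using memory_part_integrable by auto
  have shift: "integrable lborel (\<lambda>t. memory_part K (t - r))"
      "(\<integral>t. memory_part K (t - r) \<partial>lborel) = integral\<^sup>L lborel (memory_part K)" for r
    using lborel_integrable_real_affine[OF memory_part_integrable, of 1 "- r"]
      lborel_integral_real_affine[of 1 "memory_part K" "- r"] by simp_all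
  \<comment> \<open>The lower limit \<open>r < t\<close> is built into \<open>memory_part\<close>;
    only \<open>t \<le> s\<close> has to be cut off.\<close>
  define F where "F = (\<lambda>r t. ?p r * (memory_part K (t - r) * indicator {..s} t))"
  have F_meas: "case_prod F \<in> borel_measurable (lborel \<Otimes>\<^sub>M lborel)"
    unfolding F_def by measurable
  \<comment> \<open>Without the cut-off in \<open>t\<close>, translation invariance makes the inner
    integral a constant multiple of \<open>|p r|\<close>; the function \<open>F\<close> is then
    dominated.\<close>
  have "integrable (lborel \<Otimes>\<^sub>M lborel) (\<lambda>(r, t). ?p r * memory_part K (t - r))"
  proof (rule lborel_pair.Fubini_integrable)
    have "(\<lambda>r. \<integral>t. norm (case (r, t) of (r, t) \<Rightarrow> ?p r * memory_part K (t - r)) \<partial>lborel)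
      = (\<lambda>r. norm (?p r) * integral\<^sup>L lborel (memory_part K))"
      by (simp add: abs_mult memory_part_nonneg shift)
    then show "integrable lborel
        (\<lambda>r. \<integral>t. norm (case (r, t) of (r, t) \<Rightarrow> ?p r * memory_part K (t - r)) \<partial>lborel)"
      using p_int by simp
    show "(\<lambda>(r, t). ?p r * memory_part K (t - r)) \<in> borel_measurable (lborel \<Otimes>\<^sub>M lborel)"
      by measurable
    show "AE r in lborel. integrable lborel (\<lambda>t. case (r, t) of (r, t) \<Rightarrow> ?p r * memory_part K (t - r))"
      unfolding prod.case by (intro AE_I2 integrable_mult_right shift)
  qed
  then have int: "integrable (lborel \<Otimes>\<^sub>M lborel) (case_prod F)"
    by (rule Bochner_Integration.integrable_bound[OF _ F_meas])
      (auto simp: F_def indicator_def)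
  have 1: "(\<integral>r. F r t \<partial>lborel) = (if t \<in> {0..s} then LBINT r:{0..t}. K (t - r) * p r else 0)" for t
  proof (cases "t \<in> {0..s}")
    case True
    have "(LBINT r:{0..t}. K (t - r) * p r) = (LBINT r:{0..<t}. K (t - r) * p r)"
      by (rule set_integral_discrete_difference[where X = "{t}"]) auto
    also have "\<dots> = (\<integral>r. F r t \<partial>lborel)"
      unfolding F_def set_lebesgue_integral_def using True
      by (intro Bochner_Integration.integral_cong refl) (auto simp: indicator_def memory_part_def)
    finally show ?thesis using True by simp
  next
    case False
    then have "(\<lambda>r. F r t) = (\<lambda>r. 0)"
      by (auto simp: F_def memory_part_def fun_eq_iff indicator_def)
    then show ?thesis unfolding if_not_P[OF False] by simp
  qed
  have 2: "(\<integral>t. F r t \<partial>lborel) = (if r \<in> {0..s} then (1 - damp K (s - r)) * p r else 0)" for r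
  proof (cases "r \<in> {0..s}")
    case True
    have "(\<integral>t. F r t \<partial>lborel) = p r * (\<integral>t. memory_part K (t - r) * indicator {..s} t \<partial>lborel)"
      unfolding F_def using True by simp
    also have "(\<integral>t. memory_part K (t - r) * indicator {..s} t \<partial>lborel)
        = (\<integral>x. memory_part K x * indicator {..s} (r + x) \<partial>lborel)"
      using lborel_integral_real_affine[of 1 "\<lambda>t. memory_part K (t - r) * indicator {..s} t" r] by simp
    also have "\<dots> = (LBINT x:{0..s - r}. memory_part K x)"
      unfolding set_lebesgue_integral_def
      by (intro Bochner_Integration.integral_cong refl) (auto simp: indicator_def memory_part_def)
    also have "\<dots> = integral {0..s - r} (memory_part K)"
    proof (rule set_borel_integral_eq_integral(2), rule set_integrable_subset)
      show "set_integrable lborel UNIV (memory_part K)"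
        by (simp add: set_integrable_def memory_part_integrable)
    qed auto
    finally show ?thesis using True by (simp add: damp_def)
  next
    case False
    then have "(\<lambda>t. F r t) = (\<lambda>t. 0)" by (auto simp: F_def fun_eq_iff)
    then show ?thesis unfolding if_not_P[OF False] by simp
  qed
  note i1 = has_integral_integral_lborel[OF lborel_pair.integrable_snd[OF int], unfolded 1 has_integral_restrict_UNIV]
  note i2 = has_integral_integral_lborel[OF lborel_pair.integrable_fst[OF int], unfolded 2 has_integral_restrict_UNIV]
  show ?thesis
    using i1 integral_unique[OF i2] lborel_pair.Fubini_integral[OF int] by (simp add: 1 2)
qed

end

subsection \<open>The error estimate\<close>

text \<open>The discrete space enters only as a subspace of \<open>H10\<close>; the mesh and the
  polynomial degree return in the final theorem. \<open>R\<close> is not assumed to be linear or to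
  respect equality almost everywhere.\<close>

locale galerkin =
  fixes \<Omega> :: "(real ^ 'n::finite) set" and A :: "'n field \<Rightarrow> 'n field"
    and a :: "'n field \<Rightarrow> 'n field \<Rightarrow> real" and W :: "'n field set" and R :: "'n field \<Rightarrow> 'n field"
  assumes open_domain: "open \<Omega>"
    and energy: "energy_form \<Omega> A a"
    and op: "self_adjoint \<Omega> (op_domain \<Omega>) A"
    and W_sub: "W \<subseteq> H10 \<Omega>"
    and W_add: "v \<in> W \<Longrightarrow> w \<in> W \<Longrightarrow> (\<lambda>x. v x + w x) \<in> W"
    and W_scale: "v \<in> W \<Longrightarrow> (\<lambda>x. r *\<^sub>R v x) \<in> W"
    and ritz: "ritz_projection \<Omega> a W R"
begin

sublocale E: form_space "H10 \<Omega>" a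
  using open_domain energy by (rule form_space_energy)

lemma W_H10: "v \<in> W \<Longrightarrow> v \<in> H10 \<Omega>"
  and W_L2: "v \<in> W \<Longrightarrow> v \<in> L2 \<Omega>"
  using W_sub H10_imp_L2 by auto

lemma W_diff: "v \<in> W \<Longrightarrow> w \<in> W \<Longrightarrow> (\<lambda>x. v x - w x) \<in> W"
  using W_add[of v "\<lambda>x. (- 1) *\<^sub>R w x"] W_scale[of w "-1"] by simp

lemma ritz_mem: "v \<in> H10 \<Omega> \<Longrightarrow> R v \<in> W"
  and ritz_eq: "v \<in> H10 \<Omega> \<Longrightarrow> \<psi> \<in> W \<Longrightarrow> a (R v) \<psi> = a v \<psi>"
  using ritz by (auto simp: ritz_projection_def)

text \<open>Transfers the time derivatives, given in the Sobolev norm, to the energy seminorm, where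
  the calculus of \<open>form_space\<close> applies. The sign of \<open>M\<close> is not prescribed,
  hence the absolute value.\<close>

lemma energy_nrm_le: "\<exists>c\<ge>0. \<forall>v\<in>H10 \<Omega>. E.nrm v \<le> c * sobolev_norm \<Omega> 1 v"
proof -
  obtain M where M: "\<And>v. v \<in> H10 \<Omega> \<Longrightarrow> a v v \<le> M * (sobolev_norm \<Omega> 1 v)\<^sup>2"
    using energy unfolding energy_form_def by blast
  have "E.nrm v \<le> sqrt \<bar>M\<bar> * sobolev_norm \<Omega> 1 v" if v: "v \<in> H10 \<Omega>" for v
  proof -
    have "0 \<le> sobolev_norm \<Omega> 1 v"
      by (rule order.trans[OF l2norm_nonneg l2norm_le_sobolev_norm])
    moreover have "a v v \<le> \<bar>M\<bar> * (sobolev_norm \<Omega> 1 v)\<^sup>2"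
      using M[OF v] mult_right_mono[OF abs_ge_self, of "(sobolev_norm \<Omega> 1 v)\<^sup>2" M] by simp
    ultimately show ?thesis
      unfolding E.nrm_def by (metis real_sqrt_le_mono real_sqrt_mult real_sqrt_unique)
  qed
  then show ?thesis by (intro exI[of _ "sqrt \<bar>M\<bar>"]) simp
qed

lemma l2norm_le_energy: "\<exists>c\<ge>0. \<forall>v\<in>H10 \<Omega>. l2norm \<Omega> v \<le> c * E.nrm v"
proof -
  obtain m where m: "m > 0" "\<And>v. v \<in> H10 \<Omega> \<Longrightarrow> m * (sobolev_norm \<Omega> 1 v)\<^sup>2 \<le> a v v"
    using energy unfolding energy_form_def by blast
  have "l2norm \<Omega> v \<le> sqrt (1 / m) * E.nrm v" if v: "v \<in> H10 \<Omega>" for v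
  proof -
    have "(l2norm \<Omega> v)\<^sup>2 \<le> (sobolev_norm \<Omega> 1 v)\<^sup>2"
      by (intro power_mono l2norm_le_sobolev_norm l2norm_nonneg)
    also have "\<dots> \<le> 1 / m * a v v" using m(1) m(2)[OF v] by (simp add: field_simps)
    finally have "sqrt ((l2norm \<Omega> v)\<^sup>2) \<le> sqrt (1 / m * a v v)" by (rule real_sqrt_le_mono)
    then show ?thesis by (simp add: E.nrm_def real_sqrt_mult l2norm_nonneg real_sqrt_divide)
  qed
  then show ?thesis using m(1) by (intro exI[of _ "sqrt (1 / m)"]) simp
qed

text \<open>Energy stability of the Ritz projection, stated through its defining equations so that
  it also covers linear combinations of projections, which need not be values of
  \<open>R\<close>.\<close>

lemma galerkin_nrm_le:
  assumes d: "d \<in> W" and z: "z \<in> H10 \<Omega>" and eq: "\<And>\<psi>. \<psi> \<in> W \<Longrightarrow> a d \<psi> = a z \<psi>"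
  shows "E.nrm d \<le> E.nrm z"
proof (cases "E.nrm d = 0")
  case False
  have "E.nrm d * E.nrm d = a z d"
    using E.nrm_square[OF W_H10[OF d]] eq[OF d] by (simp add: power2_eq_square)
  also have "\<dots> \<le> E.nrm z * E.nrm d"
    using E.Cauchy_Schwarz[OF z W_H10[OF d]] by simp
  finally show ?thesis
    using False E.nrm_nonneg[OF W_H10[OF d]] by simp
qed (simp add: E.nrm_nonneg[OF z])

text \<open>Needed at the initial time, where \<open>u 0\<close> and the datum \<open>u0\<close>
  agree almost everywhere only.\<close>

lemma energy_cong_ae:
  assumes "v \<in> H10 \<Omega>" "w \<in> H10 \<Omega>" "ae_eq \<Omega> v w" "\<psi> \<in> H10 \<Omega>"
  shows "a v \<psi> = a w \<psi>"
proof -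
  let ?z = "\<lambda>x. v x - w x"
  have z: "?z \<in> H10 \<Omega>" using assms by (intro E.diff_mem)
  have "ae_eq \<Omega> ?z (\<lambda>x. 0)" using assms(3) by (simp add: ae_eq_def)
  then have "a ?z ?z = 0" by (rule energy_null[OF energy op z])
  then have "a ?z \<psi> = 0" using E.Cauchy_Schwarz[OF z assms(4)] by (simp add: E.nrm_def)
  then show ?thesis using assms by (simp add: E.diff_left)
qed

lemma l2norm_zero: "v \<in> H10 \<Omega> \<Longrightarrow> E.nrm v = 0 \<Longrightarrow> l2norm \<Omega> v = 0"
  using l2norm_le_energy l2norm_nonneg[of \<Omega> v] by fastforce

end

locale galerkin_solution = galerkin \<Omega> A a W R
  for \<Omega> :: "(real ^ 'n::finite) set" and A a W R +
  fixes P :: "'n field \<Rightarrow> 'n field" and K :: "real \<Rightarrow> real" and T :: real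
    and f u u' u'' uh uh' uh'' :: "real \<Rightarrow> 'n field" and u0 u1 uh0 :: "'n field"
  assumes T: "T > 0"
    and K: "memory_kernel K"
    and proj: "l2_projection \<Omega> W P"
    and u0: "u0 \<in> H10 \<Omega>" and u1: "u1 \<in> L2 \<Omega>" and uh0: "uh0 \<in> W"
    and sol: "solves \<Omega> a K T (H10 \<Omega>) f u0 u1 u u' u''"
    and sol_h: "solves \<Omega> a K T W f uh0 (P u1) uh uh' uh''"
begin

definition \<theta> :: "real \<Rightarrow> 'n field" where "\<theta> t = (\<lambda>x. uh t x - R (u t) x)"
text \<open>At this stage only a candidate; \<open>\<theta>_quotient\<close> shows that it is the
  time derivative of \<open>\<theta>\<close> in the energy seminorm.\<close>

definition \<theta>' :: "real \<Rightarrow> 'n field" where "\<theta>' t = (\<lambda>x. uh' t x - R (u' t) x)"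
definition e' :: "real \<Rightarrow> 'n field" where "e' t = (\<lambda>x. uh' t x - u' t x)"

abbreviation (input) quot :: "(real \<Rightarrow> 'n field) \<Rightarrow> (real \<Rightarrow> 'n field) \<Rightarrow> real \<Rightarrow> real \<Rightarrow> 'n field" where
  "quot v v' t s \<equiv> (\<lambda>x. (v s x - v t x) /\<^sub>R (s - t) - v' t x)"

lemma mem:
  assumes "t \<in> {0..T}"
  shows "u t \<in> H10 \<Omega>" "u' t \<in> H10 \<Omega>" "uh t \<in> W" "uh' t \<in> H10 \<Omega>"
  using sol sol_h assms unfolding solves_def by blast+

lemma \<theta>_mem: "t \<in> {0..T} \<Longrightarrow> \<theta> t \<in> W"
  unfolding \<theta>_def by (intro W_diff mem ritz_mem)

lemma \<theta>'_mem: "t \<in> {0..T} \<Longrightarrow> \<theta>' t \<in> H10 \<Omega>"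
  unfolding \<theta>'_def by (intro E.diff_mem mem W_H10 ritz_mem)

lemmas \<theta>_H10 = W_H10[OF \<theta>_mem] and \<theta>_L2 = W_L2[OF \<theta>_mem] and \<theta>'_L2 = H10_imp_L2[OF \<theta>'_mem]

lemma e'_mem: "t \<in> {0..T} \<Longrightarrow> e' t \<in> L2 \<Omega>"
  unfolding e'_def by (intro L2.diff_mem H10_imp_L2 mem)

lemma energy_\<theta>:
  assumes "t \<in> {0..T}" "\<psi> \<in> W"
  shows "a (\<theta> t) \<psi> = a (uh t) \<psi> - a (u t) \<psi>"
  unfolding \<theta>_def using assms by (simp add: E.diff_left mem W_H10 ritz_mem ritz_eq)

section \<open>Differentiability in time in the energy and L2 norms\<close>

lemma energy_quotient:
  assumes t: "t \<in> {0..T}"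
  shows "((\<lambda>s. E.nrm (quot u u' t s)) \<longlongrightarrow> 0) (at t within {0..T})"
    and "((\<lambda>s. E.nrm (quot uh uh' t s)) \<longlongrightarrow> 0) (at t within {0..T})"
proof -
  obtain c where c: "\<And>v. v \<in> H10 \<Omega> \<Longrightarrow> E.nrm v \<le> c * sobolev_norm \<Omega> 1 v"
    using energy_nrm_le by blast
  have *: "((\<lambda>s. E.nrm (quot v v' t s)) \<longlongrightarrow> 0) (at t within {0..T})"
    if lim: "((\<lambda>s. sobolev_norm \<Omega> 1 (quot v v' t s)) \<longlongrightarrow> 0) (at t within {0..T})"
      and v: "\<And>s. s \<in> {0..T} \<Longrightarrow> v s \<in> H10 \<Omega>" "v' t \<in> H10 \<Omega>" for v v'
  proof (rule Lim_null_comparison)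
    show "((\<lambda>s. c * sobolev_norm \<Omega> 1 (quot v v' t s)) \<longlongrightarrow> 0) (at t within {0..T})"
      using lim by (rule tendsto_mult_right_zero)
    have "eventually (\<lambda>s. s \<in> {0..T}) (at t within {0..T})" by (simp add: eventually_at_filter)
    then show "\<forall>\<^sub>F s in at t within {0..T}. norm (E.nrm (quot v v' t s))
        \<le> c * sobolev_norm \<Omega> 1 (quot v v' t s)"
    proof eventually_elim
      case (elim s)
      then have "quot v v' t s \<in> H10 \<Omega>" using v t by (intro E.closed) auto
      then show ?case using c E.nrm_nonneg by simp
    qed
  qed
  show "((\<lambda>s. E.nrm (quot u u' t s)) \<longlongrightarrow> 0) (at t within {0..T})"
    using sol t unfolding solves_def by (intro * mem) blast+
  show "((\<lambda>s. E.nrm (quot uh uh' t s)) \<longlongrightarrow> 0) (at t within {0..T})"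
    using sol_h t unfolding solves_def by (intro * mem W_H10) blast+
qed

lemma \<theta>_quotient:
  assumes t: "t \<in> {0..T}"
  shows "((\<lambda>s. E.nrm (quot \<theta> \<theta>' t s)) \<longlongrightarrow> 0) (at t within {0..T})"
proof (rule Lim_null_comparison)
  show "((\<lambda>s. E.nrm (quot uh uh' t s) + E.nrm (quot u u' t s)) \<longlongrightarrow> 0) (at t within {0..T})"
    using tendsto_add[OF energy_quotient(2)[OF t] energy_quotient(1)[OF t]] by simp
  have "eventually (\<lambda>s. s \<in> {0..T}) (at t within {0..T})" by (simp add: eventually_at_filter)
  then show "\<forall>\<^sub>F s in at t within {0..T}. norm (E.nrm (quot \<theta> \<theta>' t s))
      \<le> E.nrm (quot uh uh' t s) + E.nrm (quot u u' t s)"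
  proof eventually_elim
    case (elim s)
    note m = mem[OF t] mem[OF elim]
    \<comment> \<open>This need not be \<open>R\<close> of the difference quotient error of
      \<open>u\<close>, but it has the same energy products with \<open>W\<close>, so its energy
      seminorm is bounded by that of the error.\<close>
    let ?d = "\<lambda>x. (R (u s) x - R (u t) x) /\<^sub>R (s - t) - R (u' t) x"
    have d: "?d \<in> W" using m by (intro W_diff W_scale ritz_mem)
    have uq: "quot u u' t s \<in> H10 \<Omega>" "quot uh uh' t s \<in> H10 \<Omega>"
      using m by (auto intro!: E.closed intro: W_H10)
    have "a ?d \<psi> = a (quot u u' t s) \<psi>" if "\<psi> \<in> W" for \<psi>
      using m that by (simp add: E.bilinear E.closed W_H10 ritz_mem ritz_eq)
    then have "E.nrm ?d \<le> E.nrm (quot u u' t s)"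
      using d uq(1) by (intro galerkin_nrm_le)
    moreover have "E.nrm (quot \<theta> \<theta>' t s) \<le> E.nrm (quot uh uh' t s) + E.nrm ?d"
    proof -
      have "quot \<theta> \<theta>' t s = (\<lambda>x. quot uh uh' t s x - ?d x)"
        by (simp add: fun_eq_iff \<theta>_def \<theta>'_def algebra_simps)
      then show ?thesis using E.nrm_diff_le[OF uq(2) W_H10[OF d]] by simp
    qed
    moreover have "quot \<theta> \<theta>' t s \<in> H10 \<Omega>"
      using t elim by (intro E.closed \<theta>'_mem W_H10 \<theta>_mem)
    ultimately show ?case using E.nrm_nonneg by simp
  qed
qed

lemma \<theta>_quotient_L2:
  assumes t: "t \<in> {0..T}"
  shows "((\<lambda>s. l2norm \<Omega> (quot \<theta> \<theta>' t s)) \<longlongrightarrow> 0) (at t within {0..T})"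
proof -
  obtain c where c: "\<And>v. v \<in> H10 \<Omega> \<Longrightarrow> l2norm \<Omega> v \<le> c * E.nrm v"
    using l2norm_le_energy by blast
  show ?thesis
  proof (rule Lim_null_comparison)
    show "((\<lambda>s. c * E.nrm (quot \<theta> \<theta>' t s)) \<longlongrightarrow> 0) (at t within {0..T})"
      using \<theta>_quotient[OF t] by (rule tendsto_mult_right_zero)
    have "eventually (\<lambda>s. s \<in> {0..T}) (at t within {0..T})" by (simp add: eventually_at_filter)
    then show "\<forall>\<^sub>F s in at t within {0..T}. norm (l2norm \<Omega> (quot \<theta> \<theta>' t s)) \<le> c * E.nrm (quot \<theta> \<theta>' t s)"
    proof eventually_elim
      case (elim s)
      then have "quot \<theta> \<theta>' t s \<in> H10 \<Omega>"
        using t by (intro E.closed \<theta>'_mem W_H10 \<theta>_mem)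
      then show ?case using c l2norm_nonneg[of \<Omega> "quot \<theta> \<theta>' t s"] by simp
    qed
  qed
qed

lemma \<theta>_cont: "t \<in> {0..T} \<Longrightarrow> ((\<lambda>s. E.nrm (\<lambda>x. \<theta> s x - \<theta> t x)) \<longlongrightarrow> 0) (at t within {0..T})"
  by (rule E.quotient_imp_continuous[OF \<theta>_H10 _ \<theta>'_mem \<theta>_quotient])

lemma \<theta>_cont_L2: "t \<in> {0..T} \<Longrightarrow> ((\<lambda>s. l2norm \<Omega> (\<lambda>x. \<theta> s x - \<theta> t x)) \<longlongrightarrow> 0) (at t within {0..T})"
  by (rule L2.quotient_imp_continuous[OF \<theta>_L2 _ \<theta>'_L2 \<theta>_quotient_L2])

lemma energy_continuous:
  assumes "\<psi> \<in> H10 \<Omega>"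
  shows "continuous_on {0..T} (\<lambda>t. a (u t) \<psi>)" "continuous_on {0..T} (\<lambda>t. a (uh t) \<psi>)"
    "continuous_on {0..T} (\<lambda>t. a (\<theta> t) \<psi>)"
proof -
  show "continuous_on {0..T} (\<lambda>t. a (u t) \<psi>)"
    by (rule DERIV_continuous_on)
      (rule E.has_derivative_form_left[OF mem(1) _ mem(2) assms energy_quotient(1)])
  show "continuous_on {0..T} (\<lambda>t. a (uh t) \<psi>)"
    by (rule DERIV_continuous_on)
      (rule E.has_derivative_form_left[OF W_H10[OF mem(3)] _ mem(4) assms energy_quotient(2)])
  show "continuous_on {0..T} (\<lambda>t. a (\<theta> t) \<psi>)"
    by (rule DERIV_continuous_on)
      (rule E.has_derivative_form_left[OF \<theta>_H10 _ \<theta>'_mem assms \<theta>_quotient])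
qed

text \<open>Joint continuity is required for the Riemann sums on the square; it follows from
  continuity of \<open>\<theta>\<close> in the energy seminorm.\<close>

lemma gram_continuous: "continuous_on ({0..T} \<times> {0..T}) (\<lambda>(t, s). a (\<theta> t) (\<theta> s))"
  unfolding continuous_on_def
proof (intro ballI)
  fix p assume "p \<in> {0..T} \<times> {0..T}"
  then obtain t s where p: "p = (t, s)" "t \<in> {0..T}" "s \<in> {0..T}" by auto
  let ?F = "at p within {0..T} \<times> {0..T}"
  have ev: "eventually (\<lambda>q. q \<in> {0..T} \<times> {0..T}) ?F" by (simp add: eventually_at_filter)
  have cont: "continuous (at r within {0..T}) (\<lambda>q. E.nrm (\<lambda>x. \<theta> q x - \<theta> r x))" if "r \<in> {0..T}" for r
    using \<theta>_cont[OF that] E.nrm_zero[OF W_H10[OF \<theta>_mem[OF that]]] by (simp add: continuous_within)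
  have "((\<lambda>q. E.nrm (\<lambda>x. \<theta> (fst q) x - \<theta> t x)) \<longlongrightarrow> E.nrm (\<lambda>x. \<theta> t x - \<theta> t x)) ?F"
    using p by (intro continuous_within_tendsto_compose[OF cont] eventually_mono[OF ev] tendsto_eq_intros) auto
  moreover have "((\<lambda>q. E.nrm (\<lambda>x. \<theta> (snd q) x - \<theta> s x)) \<longlongrightarrow> E.nrm (\<lambda>x. \<theta> s x - \<theta> s x)) ?F"
    using p by (intro continuous_within_tendsto_compose[OF cont] eventually_mono[OF ev] tendsto_eq_intros) auto
  ultimately have "((\<lambda>q. a (\<theta> (fst q)) (\<theta> (snd q))) \<longlongrightarrow> a (\<theta> t) (\<theta> s)) ?F"
    using p E.nrm_zero[OF W_H10[OF \<theta>_mem[OF p(2)]]]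
    by (intro E.tendsto_form eventually_mono[OF ev] W_H10 \<theta>_mem) auto
  then show "((\<lambda>(t, s). a (\<theta> t) (\<theta> s)) \<longlongrightarrow> (case p of (t, s) \<Rightarrow> a (\<theta> t) (\<theta> s))) ?F"
    by (simp add: p case_prod_beta')
qed

section \<open>The error equation and its time integral\<close>

lemma error_equation:
  assumes t: "t \<in> {0<..<T}" and \<psi>: "\<psi> \<in> W"
  shows "l2inner \<Omega> (\<lambda>x. uh'' t x - u'' t x) \<psi>
    = - a (\<theta> t) \<psi> + (LBINT s:{0..t}. K (t - s) * a (\<theta> s) \<psi>)"
proof -
  have sub: "{0..t} \<subseteq> {0..T}" and t': "t \<in> {0..T}" using t by auto
  have L: "u'' t \<in> L2 \<Omega>" "uh'' t \<in> L2 \<Omega>" using sol sol_h t unfolding solves_def by blast+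
  have "l2inner \<Omega> (u'' t) \<psi> + a (u t) \<psi> - (LBINT s:{0..t}. K (t - s) * a (u s) \<psi>) = l2inner \<Omega> (f t) \<psi>"
    using sol t W_H10[OF \<psi>] unfolding solves_def by blast
  moreover have "l2inner \<Omega> (uh'' t) \<psi> + a (uh t) \<psi> - (LBINT s:{0..t}. K (t - s) * a (uh s) \<psi>) = l2inner \<Omega> (f t) \<psi>"
    using sol_h t \<psi> unfolding solves_def by blast
  \<comment> \<open>Ritz orthogonality at every earlier time replaces the full error by
    \<open>\<theta>\<close> under the memory integral too; the inertia term keeps the full
    error.\<close>
  moreover have "(LBINT s:{0..t}. K (t - s) * a (\<theta> s) \<psi>)
      = (LBINT s:{0..t}. K (t - s) * a (uh s) \<psi> - K (t - s) * a (u s) \<psi>)"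
    using sub \<psi> by (intro set_lebesgue_integral_cong) (auto simp: energy_\<theta> right_diff_distrib)
  moreover have "\<dots> = (LBINT s:{0..t}. K (t - s) * a (uh s) \<psi>) - (LBINT s:{0..t}. K (t - s) * a (u s) \<psi>)"
    using energy_continuous[OF W_H10[OF \<psi>]] sub
    by (intro set_integral_diff memory_set_integrable[OF K]) (auto intro: continuous_on_subset)
  ultimately show ?thesis
    using energy_\<theta>[OF t' \<psi>] L W_L2[OF \<psi>] by (simp add: L2.diff_left)
qed

lemma e'_cont:
  assumes t: "t \<in> {0..T}"
  shows "((\<lambda>s. l2norm \<Omega> (\<lambda>x. e' s x - e' t x)) \<longlongrightarrow> 0) (at t within {0..T})"
proof (rule Lim_null_comparison)
  let ?N = "\<lambda>s. l2norm \<Omega> (\<lambda>x. uh' s x - uh' t x) + l2norm \<Omega> (\<lambda>x. u' s x - u' t x)"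
  have "((\<lambda>s. l2norm \<Omega> (\<lambda>x. uh' s x - uh' t x)) \<longlongrightarrow> 0) (at t within {0..T})"
    "((\<lambda>s. l2norm \<Omega> (\<lambda>x. u' s x - u' t x)) \<longlongrightarrow> 0) (at t within {0..T})"
    using sol sol_h t unfolding solves_def by blast+
  from tendsto_add[OF this] show "(?N \<longlongrightarrow> 0) (at t within {0..T})" by simp
  have "eventually (\<lambda>s. s \<in> {0..T}) (at t within {0..T})" by (simp add: eventually_at_filter)
  then show "\<forall>\<^sub>F s in at t within {0..T}. norm (l2norm \<Omega> (\<lambda>x. e' s x - e' t x)) \<le> ?N s"
  proof eventually_elim
    case (elim s)
    have "(\<lambda>x. e' s x - e' t x) = (\<lambda>x. (uh' s x - uh' t x) - (u' s x - u' t x))"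
      by (simp add: e'_def fun_eq_iff)
    moreover have "l2norm \<Omega> \<dots> \<le> ?N s"
      using mem[OF t] mem[OF elim] by (intro L2.nrm_diff_le L2.diff_mem H10_imp_L2)
    ultimately show ?case using l2norm_nonneg[of \<Omega> "\<lambda>x. e' s x - e' t x"] by simp
  qed
qed

lemma e'_quotient:
  assumes t: "t \<in> {0<..<T}"
  shows "((\<lambda>s. l2norm \<Omega> (\<lambda>x. (e' s x - e' t x) /\<^sub>R (s - t) - (uh'' t x - u'' t x))) \<longlongrightarrow> 0)
    (at t within {0..T})"
proof (rule Lim_null_comparison)
  have t': "t \<in> {0..T}" using t by auto
  have L: "u'' t \<in> L2 \<Omega>" "uh'' t \<in> L2 \<Omega>" using sol sol_h t unfolding solves_def by blast+
  let ?N = "\<lambda>s. l2norm \<Omega> (quot uh' uh'' t s) + l2norm \<Omega> (quot u' u'' t s)"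
  have "((\<lambda>s. l2norm \<Omega> (quot uh' uh'' t s)) \<longlongrightarrow> 0) (at t)"
    "((\<lambda>s. l2norm \<Omega> (quot u' u'' t s)) \<longlongrightarrow> 0) (at t)"
    using sol sol_h t unfolding solves_def by blast+
  from tendsto_add[OF this] have "(?N \<longlongrightarrow> 0) (at t)" by simp
  then show "(?N \<longlongrightarrow> 0) (at t within {0..T})" by (rule tendsto_within_subset) simp
  have "eventually (\<lambda>s. s \<in> {0..T}) (at t within {0..T})" by (simp add: eventually_at_filter)
  then show "\<forall>\<^sub>F s in at t within {0..T}.
      norm (l2norm \<Omega> (\<lambda>x. (e' s x - e' t x) /\<^sub>R (s - t) - (uh'' t x - u'' t x))) \<le> ?N s"
  proof eventually_elim
    case (elim s)
    have "(\<lambda>x. (e' s x - e' t x) /\<^sub>R (s - t) - (uh'' t x - u'' t x))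
        = (\<lambda>x. quot uh' uh'' t s x - quot u' u'' t s x)"
      by (simp add: e'_def fun_eq_iff algebra_simps)
    moreover have "l2norm \<Omega> \<dots> \<le> ?N s"
      using mem(2,4)[OF t', THEN H10_imp_L2] mem(2,4)[OF elim, THEN H10_imp_L2] L
      by (intro L2.nrm_diff_le L2.closed)
    ultimately show ?case
      using l2norm_nonneg[of \<Omega> "\<lambda>x. (e' s x - e' t x) /\<^sub>R (s - t) - (uh'' t x - u'' t x)"] by simp
  qed
qed

text \<open>The L2 projection is the choice of discrete initial velocity whose error is orthogonal
  to \<open>W\<close>.\<close>

lemma e'_initial:
  assumes \<psi>: "\<psi> \<in> W"
  shows "l2inner \<Omega> (e' 0) \<psi> = 0"
proof -
  have 0: "0 \<in> {0..T}" using T by simp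
  have Pu1: "P u1 \<in> W" "l2inner \<Omega> (P u1) \<psi> = l2inner \<Omega> u1 \<psi>"
    using proj u1 \<psi> unfolding l2_projection_def by blast+
  have "ae_eq \<Omega> (u' 0) u1" "ae_eq \<Omega> (uh' 0) (P u1)"
    using sol sol_h unfolding solves_def by blast+
  moreover have "ae_eq \<Omega> \<psi> \<psi>" by (simp add: ae_eq_def)
  ultimately have "l2inner \<Omega> (u' 0) \<psi> = l2inner \<Omega> u1 \<psi>" "l2inner \<Omega> (uh' 0) \<psi> = l2inner \<Omega> (P u1) \<psi>"
    using mem(2,4)[OF 0, THEN H10_imp_L2] W_L2[OF \<psi>] W_L2[OF Pu1(1)] u1
    by (auto intro: l2inner_cong_ae)
  then show ?thesis
    unfolding e'_def using mem[OF 0] \<psi> Pu1(2) by (simp add: L2.diff_left H10_imp_L2 W_L2)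
qed

lemma integrated_error_equation:
  assumes s: "s \<in> {0..T}" and \<psi>: "\<psi> \<in> W"
  shows "l2inner \<Omega> (e' s) \<psi> = - integral {0..s} (\<lambda>t. damp K (s - t) * a (\<theta> t) \<psi>)"
proof -
  have sub: "{0..s} \<subseteq> {0..T}" using s by auto
  let ?p = "\<lambda>t. a (\<theta> t) \<psi>" and ?c = "\<lambda>t. LBINT r:{0..t}. K (t - r) * a (\<theta> r) \<psi>"
  have p: "continuous_on {0..s} ?p"
    using energy_continuous(3)[OF W_H10[OF \<psi>]] sub by (rule continuous_on_subset)
  have dp: "continuous_on {0..s} (\<lambda>t. damp K (s - t) * ?p t)"
    by (intro continuous_on_mult p continuous_on_compose2[OF damp_continuous[OF K, of s]] continuous_intros) auto
  have cont: "continuous_on {0..s} (\<lambda>t. l2inner \<Omega> (e' t) \<psi>)"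
  proof (rule continuous_on_subset[OF _ sub], unfold continuous_on_def, intro ballI)
    fix t assume t: "t \<in> {0..T}"
    have "eventually (\<lambda>s. s \<in> {0..T}) (at t within {0..T})" by (simp add: eventually_at_filter)
    then show "((\<lambda>t. l2inner \<Omega> (e' t) \<psi>) \<longlongrightarrow> l2inner \<Omega> (e' t) \<psi>) (at t within {0..T})"
      using t \<psi> by (intro L2.tendsto_form e'_cont e'_mem W_L2)
        (auto elim!: eventually_mono intro: e'_mem W_L2 simp: L2.nrm_zero[OF W_L2[OF \<psi>]])
  qed
  have "((\<lambda>t. - ?p t + ?c t) has_integral l2inner \<Omega> (e' s) \<psi> - l2inner \<Omega> (e' 0) \<psi>) {0..s}"
  \<comment> \<open>Second time derivatives exist on the open interval only; continuity of the
    velocities in L2 covers the end points.\<close>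
  proof (rule fundamental_theorem_of_calculus_interior[OF _ cont])
    show "0 \<le> s" using s by simp
    fix t assume "t \<in> {0<..<s}"
    then have t: "t \<in> {0<..<T}" "t \<in> {0..T}" using s by auto
    have L: "u'' t \<in> L2 \<Omega>" "uh'' t \<in> L2 \<Omega>" using sol sol_h t unfolding solves_def by blast+
    have "((\<lambda>t. l2inner \<Omega> (e' t) \<psi>) has_real_derivative l2inner \<Omega> (\<lambda>x. uh'' t x - u'' t x) \<psi>) (at t within {0..T})"
      using e'_quotient[OF t(1)] t L W_L2[OF \<psi>] by (intro L2.has_derivative_form_left e'_mem L2.diff_mem)
    then show "((\<lambda>t. l2inner \<Omega> (e' t) \<psi>) has_vector_derivative - ?p t + ?c t) (at t)"
      unfolding error_equation[OF t(1) \<psi>] has_real_derivative_iff_has_vector_derivative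
      using t(1) by (simp add: at_within_Icc_at)
  qed
  moreover have "((\<lambda>t. - ?p t + ?c t) has_integral
      - integral {0..s} ?p + integral {0..s} (\<lambda>t. (1 - damp K (s - t)) * ?p t)) {0..s}"
    by (intro has_integral_add has_integral_neg integrable_integral integrable_continuous_interval
        memory_double_integral[OF K] p)
  \<comment> \<open>The 1 in \<open>1 - damp\<close> cancels the undamped energy term, so only the
    damped integral is left.\<close>
  moreover have "integral {0..s} (\<lambda>t. (1 - damp K (s - t)) * ?p t)
      = integral {0..s} ?p - integral {0..s} (\<lambda>t. damp K (s - t) * ?p t)"
    using p dp by (simp add: left_diff_distrib Henstock_Kurzweil_Integration.integral_diff integrable_continuous_interval)
  ultimately show ?thesis
    using e'_initial[OF \<psi>] by (auto dest: has_integral_unique)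
qed

section \<open>Testing with \<theta> and bounding its maximum\<close>

lemma e'_\<theta>_continuous: "continuous_on {0..T} (\<lambda>t. l2inner \<Omega> (e' t) (\<theta> t))"
  unfolding continuous_on_def
proof (intro ballI)
  fix t assume t: "t \<in> {0..T}"
  have "eventually (\<lambda>s. s \<in> {0..T}) (at t within {0..T})" by (simp add: eventually_at_filter)
  then show "((\<lambda>t. l2inner \<Omega> (e' t) (\<theta> t)) \<longlongrightarrow> l2inner \<Omega> (e' t) (\<theta> t)) (at t within {0..T})"
    using t by (intro L2.tendsto_form e'_cont \<theta>_cont_L2 e'_mem \<theta>_L2)
      (auto elim!: eventually_mono intro: e'_mem \<theta>_L2)
qed

lemma e'_\<theta>_integral_nonpos:
  assumes \<tau>: "\<tau> \<in> {0..T}"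
  shows "integral {0..\<tau>} (\<lambda>s. l2inner \<Omega> (e' s) (\<theta> s)) \<le> 0"
proof -
  have sub: "{0..\<tau>} \<subseteq> {0..T}" using \<tau> by auto
  have "0 \<le> integral {0..\<tau>} (\<lambda>s. integral {0..s} (\<lambda>t. damp K (s - t) * a (\<theta> t) (\<theta> s)))"
  proof (rule damp_form_nonneg[OF K])
    show "continuous_on ({0..\<tau>} \<times> {0..\<tau>}) (\<lambda>(t, s). a (\<theta> t) (\<theta> s))"
      using sub by (intro continuous_on_subset[OF gram_continuous]) auto
    show "a (\<theta> s) (\<theta> t) = a (\<theta> t) (\<theta> s)" if "s \<in> {0..\<tau>}" "t \<in> {0..\<tau>}" for s t
      using that sub by (intro E.sym W_H10 \<theta>_mem) auto
    show "0 \<le> (\<Sum>i\<in>I. \<Sum>j\<in>I. a (\<theta> (x i)) (\<theta> (x j)))" if "finite I" "x ` I \<subseteq> {0..\<tau>}" for I :: "nat set" and x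
      using that sub by (intro E.gram_sum_nonneg W_H10 \<theta>_mem) auto
  qed (use \<tau> in simp)
  \<comment> \<open>The integrated equation holds at each \<open>s\<close> for every fixed test
    function, so \<open>\<psi> = \<theta> s\<close> may vary with \<open>s\<close> without being
    differentiated.\<close>
  also have "\<dots> = integral {0..\<tau>} (\<lambda>s. - l2inner \<Omega> (e' s) (\<theta> s))"
    using sub by (intro Henstock_Kurzweil_Integration.integral_cong)
      (auto simp: integrated_error_equation \<theta>_mem)
  finally show ?thesis by simp
qed

text \<open>
  The time derivative of $\|\theta\|^2$ need not be continuous, since $\dot u$ is continuous only into
  $L_2$ and the Ritz projection acts on $H^1_0$; its Henstock-Kurzweil integral exists nevertheless.
\<close>

theorem error_bound:
  assumes \<rho>: "\<And>t. t \<in> {0<..<T} \<Longrightarrow> l2norm \<Omega> (\<lambda>x. R (u' t) x - u' t x) \<le> \<rho> t"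
    and \<rho>_int: "set_integrable lborel {0<..<T} \<rho>"
  shows "l2norm \<Omega> (\<lambda>x. uh T x - u T x) \<le> l2norm \<Omega> (\<lambda>x. uh0 x - R u0 x)
    + 2 * (LBINT t:{0<..<T}. \<rho> t) + l2norm \<Omega> (\<lambda>x. R (u T) x - u T x)"
proof -
  define I where "I = (LBINT t:{0<..<T}. \<rho> t)"
  define q where "q t = l2norm \<Omega> (\<theta> t)" for t
  \<comment> \<open>The integrable majorant \<open>\<rho>\<close> stands in for the Ritz error of
    the velocity, whose measurability in time is not established.\<close>
  have \<rho>_pos: "0 \<le> \<rho> t" if "t \<in> {0<..<T}" for t
    using \<rho>[OF that] l2norm_nonneg by (rule order.trans[rotated])
  have \<rho>_hk: "\<rho> integrable_on {0<..<T}" and I: "I = integral {0<..<T} \<rho>"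
    using set_borel_integral_eq_integral[OF \<rho>_int] by (simp_all add: I_def)
  have q2: "(q t)\<^sup>2 = l2inner \<Omega> (\<theta> t) (\<theta> t)" if "t \<in> {0..T}" for t
    unfolding q_def using that by (intro L2.nrm_square W_L2 \<theta>_mem)
  have deriv: "((\<lambda>t. l2inner \<Omega> (\<theta> t) (\<theta> t)) has_real_derivative 2 * l2inner \<Omega> (\<theta>' t) (\<theta> t)) (at t within {0..T})"
    if "t \<in> {0..T}" for t
    using that by (intro L2.has_derivative_square \<theta>_quotient_L2 W_L2 \<theta>_mem H10_imp_L2 \<theta>'_mem)
  have q_cont: "continuous_on {0..T} q"
    unfolding q_def[abs_def] l2norm_def
    by (intro continuous_on_real_sqrt DERIV_continuous_on[OF deriv])
  obtain \<tau> where \<tau>: "\<tau> \<in> {0..T}" and max: "\<And>t. t \<in> {0..T} \<Longrightarrow> q t \<le> q \<tau>"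
    using continuous_attains_sup[OF compact_Icc _ q_cont] T by auto
  have q_pos: "0 \<le> q t" for t by (simp add: q_def l2norm_nonneg)
  have "(q \<tau>)\<^sup>2 - (q 0)\<^sup>2 \<le> 2 * integral {0..\<tau>} (\<lambda>t. l2inner \<Omega> (e' t) (\<theta> t)) + 2 * (q \<tau> * integral {0<..<\<tau>} \<rho>)"
  proof (rule has_integral_le)
    have "((\<lambda>t. 2 * l2inner \<Omega> (\<theta>' t) (\<theta> t)) has_integral
        l2inner \<Omega> (\<theta> \<tau>) (\<theta> \<tau>) - l2inner \<Omega> (\<theta> 0) (\<theta> 0)) {0..\<tau>}"
    proof (rule fundamental_theorem_of_calculus)
      fix t assume "t \<in> {0..\<tau>}"
      then have "((\<lambda>t. l2inner \<Omega> (\<theta> t) (\<theta> t)) has_real_derivative 2 * l2inner \<Omega> (\<theta>' t) (\<theta> t)) (at t within {0..\<tau>})"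
        using \<tau> by (intro DERIV_subset[OF deriv]) auto
      then show "((\<lambda>t. l2inner \<Omega> (\<theta> t) (\<theta> t)) has_vector_derivative 2 * l2inner \<Omega> (\<theta>' t) (\<theta> t)) (at t within {0..\<tau>})"
        by (simp add: has_real_derivative_iff_has_vector_derivative)
    qed (use \<tau> in simp)
    \<comment> \<open>The comparison is made on the open interval because \<open>\<rho>\<close> is a
      bound for \<open>0 < t < T\<close> only.\<close>
    then show "((\<lambda>t. 2 * l2inner \<Omega> (\<theta>' t) (\<theta> t)) has_integral (q \<tau>)\<^sup>2 - (q 0)\<^sup>2) {0<..<\<tau>}"
      using q2[OF \<tau>] q2[of 0] T by (simp add: has_integral_Icc_iff_Ioo)
    have e_int: "(\<lambda>t. l2inner \<Omega> (e' t) (\<theta> t)) integrable_on {0..\<tau>}"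
      using \<tau> by (intro integrable_continuous_interval continuous_on_subset[OF e'_\<theta>_continuous]) auto
    have "\<rho> integrable_on {0..T}" using \<rho>_hk by (simp add: integrable_on_open_interval_real)
    then have "\<rho> integrable_on {0..\<tau>}" by (rule integrable_on_subinterval) (use \<tau> in auto)
    then have "\<rho> integrable_on {0<..<\<tau>}" by (simp add: integrable_on_open_interval_real)
    then show "((\<lambda>t. 2 * l2inner \<Omega> (e' t) (\<theta> t) + 2 * (q \<tau> * \<rho> t)) has_integral
        2 * integral {0..\<tau>} (\<lambda>t. l2inner \<Omega> (e' t) (\<theta> t)) + 2 * (q \<tau> * integral {0<..<\<tau>} \<rho>)) {0<..<\<tau>}"
      using integrable_integral[OF e_int]
      by (intro has_integral_add has_integral_mult_right integrable_integral)
        (auto simp: has_integral_Icc_iff_Ioo)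
    fix t assume "t \<in> {0<..<\<tau>}"
    then have t: "t \<in> {0<..<T}" "t \<in> {0..T}" using \<tau> by auto
    let ?\<omega> = "\<lambda>x. R (u' t) x - u' t x"
    have \<omega>: "?\<omega> \<in> L2 \<Omega>"
      using mem[OF t(2)] by (intro L2.diff_mem W_L2 ritz_mem H10_imp_L2)
    have \<theta>L: "\<theta> t \<in> L2 \<Omega>" using t by (intro W_L2 \<theta>_mem)
    have "\<theta>' t = (\<lambda>x. e' t x - ?\<omega> x)" by (simp add: \<theta>'_def e'_def)
    then have "l2inner \<Omega> (\<theta>' t) (\<theta> t) = l2inner \<Omega> (e' t) (\<theta> t) - l2inner \<Omega> ?\<omega> (\<theta> t)"
      using t \<omega> \<theta>L by (simp add: L2.diff_left e'_mem)
    also have "\<dots> \<le> l2inner \<Omega> (e' t) (\<theta> t) + l2norm \<Omega> ?\<omega> * q t"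
      using L2.Cauchy_Schwarz[OF \<omega> \<theta>L] by (simp add: q_def)
    also have "l2norm \<Omega> ?\<omega> * q t \<le> \<rho> t * q \<tau>"
      using \<rho>[OF t(1)] max[OF t(2)] q_pos \<rho>_pos[OF t(1)] by (intro mult_mono) auto
    finally show "2 * l2inner \<Omega> (\<theta>' t) (\<theta> t) \<le> 2 * l2inner \<Omega> (e' t) (\<theta> t) + 2 * (q \<tau> * \<rho> t)"
      by (simp add: mult.commute)
  qed
  also have "\<dots> \<le> 2 * (q \<tau> * I)"
  proof -
    have "\<rho> integrable_on {0..T}" using \<rho>_hk by (simp add: integrable_on_open_interval_real)
    then have "\<rho> integrable_on {0..\<tau>}" by (rule integrable_on_subinterval) (use \<tau> in auto)
    then have "integral {0<..<\<tau>} \<rho> \<le> I"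
      unfolding I using \<tau> \<rho>_hk \<rho>_pos
      by (intro integral_subset_le) (auto simp: integrable_on_open_interval_real)
    then show ?thesis
      using e'_\<theta>_integral_nonpos[OF \<tau>] q_pos[of \<tau>] mult_left_mono[of "integral {0<..<\<tau>} \<rho>" I "q \<tau>"] by linarith
  qed
  finally have *: "(q \<tau>)\<^sup>2 \<le> (q 0)\<^sup>2 + 2 * (q \<tau> * I)" by simp
  have I_pos: "0 \<le> I"
    unfolding I using \<rho>_hk \<rho>_pos by (intro Henstock_Kurzweil_Integration.integral_nonneg) auto
  have q\<tau>: "q \<tau> \<le> q 0 + 2 * I"
  proof (cases "q \<tau> = 0")
    case False
    \<comment> \<open>Maximality also at time 0 makes every term of the quadratic inequality
      divisible by \<open>q \<tau>\<close>.\<close>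
    have "(q 0)\<^sup>2 \<le> q \<tau> * q 0"
      unfolding power2_eq_square using max[of 0] q_pos T by (intro mult_right_mono) auto
    with * have "q \<tau> * q \<tau> \<le> q \<tau> * (q 0 + 2 * I)" by (simp add: power2_eq_square algebra_simps)
    then show ?thesis using False q_pos[of \<tau>] by simp
  qed (use q_pos[of 0] I_pos in simp)
  have T': "T \<in> {0..T}" "0 \<in> {0..T}" using T by auto
  have "q 0 = l2norm \<Omega> (\<lambda>x. uh0 x - R u0 x)"
  proof -
    \<comment> \<open>\<open>R\<close> could give different fields for \<open>u 0\<close> and
      \<open>u0\<close>; their difference has energy 0, hence L2 norm 0.\<close>
    let ?d = "\<lambda>x. R (u 0) x - R u0 x"
    have ae: "ae_eq \<Omega> (u 0) u0" "ae_eq \<Omega> (uh 0) uh0"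
      using sol sol_h unfolding solves_def by blast+
    have d: "?d \<in> W" using mem[OF T'(2)] u0 by (intro W_diff ritz_mem)
    have "a ?d ?d = 0"
      using mem[OF T'(2)] u0 d ae by (simp add: E.diff_left W_H10 ritz_mem ritz_eq energy_cong_ae[OF _ _ ae(1)])
    then have d0: "l2norm \<Omega> ?d = 0" using d by (intro l2norm_zero W_H10) (simp_all add: E.nrm_def)
    have L: "(\<lambda>x. uh0 x - R u0 x) \<in> L2 \<Omega>" "\<theta> 0 \<in> L2 \<Omega>" "(\<lambda>x. uh0 x - R (u 0) x) \<in> L2 \<Omega>"
      by (intro L2.diff_mem W_L2 ritz_mem uh0 u0 mem \<theta>_mem T'(2))+
    have "l2norm \<Omega> (\<theta> 0) = l2norm \<Omega> (\<lambda>x. uh0 x - R (u 0) x)"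
      unfolding l2norm_def using ae(2) L
      by (intro arg_cong[of _ _ sqrt] l2inner_cong_ae) (auto simp: ae_eq_def \<theta>_def)
    moreover have "l2norm \<Omega> (\<lambda>x. uh0 x - R (u 0) x) = l2norm \<Omega> (\<lambda>x. uh0 x - R u0 x)"
      using L2.nrm_diff_le[OF L(1) W_L2[OF d]] L2.nrm_triangle[OF L(3) W_L2[OF d]] d0 by simp
    ultimately show ?thesis by (simp add: q_def)
  qed
  moreover have "l2norm \<Omega> (\<lambda>x. uh T x - u T x) \<le> q T + l2norm \<Omega> (\<lambda>x. R (u T) x - u T x)"
  proof -
    have "(\<lambda>x. uh T x - u T x) = (\<lambda>x. \<theta> T x + (R (u T) x - u T x))"
      by (simp add: \<theta>_def)
    then show ?thesis
      unfolding q_def using mem[OF T'(1)] T'(1)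
      by (simp only:) (intro L2.nrm_triangle L2.diff_mem W_L2 \<theta>_mem ritz_mem H10_imp_L2)
  qed
  ultimately show ?thesis using q\<tau> max[OF T'(1)] by (simp add: I_def)
qed

end

text \<open>The constant is built from the one in \<open>ritz_estimate\<close> before a
  triangulation or a solution is fixed; this is the independence of the mesh size and of
  \<open>u\<close>.\<close>

theorem theorem3:
  fixes \<Omega> :: "(real ^ 'n::finite) set"
    and A :: "'n field \<Rightarrow> 'n field"
    and a :: "'n field \<Rightarrow> 'n field \<Rightarrow> real"
    and X :: "nat \<Rightarrow> 'n field set"
    and N :: "nat \<Rightarrow> 'n field \<Rightarrow> real"
    and K :: "real \<Rightarrow> real"
    and T :: real
    and l :: nat
    and \<TT> :: "(real ^ 'n) set set set"
    and P R :: "(real ^ 'n) set set \<Rightarrow> 'n field \<Rightarrow> 'n field"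
  assumes "T > 0"
    and "polygonal_domain \<Omega>"
    and "elliptic_operator \<Omega> A"
    and "self_adjoint \<Omega> (op_domain \<Omega>) A"
    and "positive_definite \<Omega> (op_domain \<Omega>) A"
    and "elliptic_regularity \<Omega> A"
    and "energy_form \<Omega> A a"
    and "norm_scale \<Omega> A X N"
    and "memory_kernel K"
    and "l \<ge> 2"
    and "regular_family \<Omega> \<TT>"
    and "\<And>\<T>. \<T> \<in> \<TT> \<Longrightarrow> l2_projection \<Omega> (fe_space \<Omega> l \<T>) (P \<T>)"
    and "\<And>\<T>. \<T> \<in> \<TT> \<Longrightarrow> ritz_projection \<Omega> a (fe_space \<Omega> l \<T>) (R \<T>)"
    and "ritz_estimate \<Omega> X N l \<TT> R"
  shows "\<exists>C. \<forall>\<T>\<in>\<TT>. \<forall>f u0 u1 u u' u'' uh0 uh uh' uh''.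
    u0 \<in> H10 \<Omega> \<longrightarrow> u1 \<in> L2 \<Omega> \<longrightarrow>
    solves \<Omega> a K T (H10 \<Omega>) f u0 u1 u u' u'' \<longrightarrow>
    u T \<in> X l \<longrightarrow> (\<forall>t\<in>{0<..<T}. u' t \<in> X l) \<longrightarrow>
    set_integrable lborel {0<..<T} (\<lambda>t. N l (u' t)) \<longrightarrow>
    uh0 \<in> fe_space \<Omega> l \<T> \<longrightarrow>
    solves \<Omega> a K T (fe_space \<Omega> l \<T>) f uh0 (P \<T> u1) uh uh' uh'' \<longrightarrow>
    l2norm \<Omega> (\<lambda>x. uh T x - u T x)
      \<le> C * l2norm \<Omega> (\<lambda>x. uh0 x - R \<T> u0 x)
        + C * mesh_size \<T> ^ l * (N l (u T) + (LBINT t:{0<..<T}. N l (u' t)))"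
proof -
  obtain C where C: "\<And>\<T> i v. \<T> \<in> \<TT> \<Longrightarrow> i \<in> {1..l} \<Longrightarrow> v \<in> X i \<Longrightarrow>
      l2norm \<Omega> (\<lambda>x. R \<T> v x - v x) + mesh_size \<T> * N 1 (\<lambda>x. R \<T> v x - v x)
        \<le> C * mesh_size \<T> ^ i * N i v"
    using \<open>ritz_estimate \<Omega> X N l \<TT> R\<close> unfolding ritz_estimate_def by blast
  have \<Omega>: "open \<Omega>" "\<Omega> \<noteq> {}"
    using \<open>polygonal_domain \<Omega>\<close> by (auto simp: polygonal_domain_def)
  have N_nonneg: "0 \<le> N i v" for i v
    using \<open>norm_scale \<Omega> A X N\<close> unfolding norm_scale_def
    by (auto simp: l2norm_nonneg sobolev_norm_nonneg)
  have mesh: "0 \<le> mesh_size \<T>" if "\<T> \<in> \<TT>" for \<T>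
  proof -
    have "triangulation_of \<Omega> \<T>" using \<open>regular_family \<Omega> \<TT>\<close> that by (auto simp: regular_family_def)
    then show ?thesis using \<Omega>(2) by (rule mesh_size_nonneg)
  qed
  \<comment> \<open>The 1 serves the initial error and \<open>2 * |C|\<close> the velocity integral
    with its factor 2. The absolute value is taken because \<open>ritz_estimate\<close> does not
    prescribe the sign of its constant.\<close>
  define C' where "C' = 1 + 2 * \<bar>C\<bar>"
  show ?thesis
  proof (intro exI[of _ C'] ballI allI impI)
    fix \<T> f u0 u1 u u' u'' uh0 uh uh' uh''
    assume \<T>: "\<T> \<in> \<TT>" and init: "u0 \<in> H10 \<Omega>" "u1 \<in> L2 \<Omega>"
      and sol: "solves \<Omega> a K T (H10 \<Omega>) f u0 u1 u u' u''"
      and reg: "u T \<in> X l" "\<forall>t\<in>{0<..<T}. u' t \<in> X l"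
      and int: "set_integrable lborel {0<..<T} (\<lambda>t. N l (u' t))"
      and uh0: "uh0 \<in> fe_space \<Omega> l \<T>"
      and sol_h: "solves \<Omega> a K T (fe_space \<Omega> l \<T>) f uh0 (P \<T> u1) uh uh' uh''"
    interpret galerkin_solution \<Omega> A a "fe_space \<Omega> l \<T>" "R \<T>" "P \<T>" K T f u u' u'' uh uh' uh'' u0 u1 uh0
    proof
      show "fe_space \<Omega> l \<T> \<subseteq> H10 \<Omega>" by (auto simp: fe_space_def)
    qed (fact | (rule fe_space_add[OF \<Omega>(1)] fe_space_scale[OF \<Omega>(1)]; assumption)
        | rule assms(12,13)[OF \<T>])+
    let ?h = "mesh_size \<T> ^ l"
    have h: "0 \<le> ?h" using mesh[OF \<T>] by simp
    have ritz_le: "l2norm \<Omega> (\<lambda>x. R \<T> v x - v x) \<le> \<bar>C\<bar> * ?h * N l v" if "v \<in> X l" for v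
    proof -
      \<comment> \<open>The gradient part of the Ritz estimate is dropped, being a product of
        nonnegative factors.\<close>
      have "l2norm \<Omega> (\<lambda>x. R \<T> v x - v x) \<le> C * ?h * N l v"
        using C[OF \<T> _ that] \<open>2 \<le> l\<close> mult_nonneg_nonneg[OF mesh[OF \<T>] N_nonneg[of 1 "\<lambda>x. R \<T> v x - v x"]]
        by simp
      also have "\<dots> \<le> \<bar>C\<bar> * ?h * N l v"
        using h N_nonneg by (intro mult_right_mono) auto
      finally show ?thesis .
    qed
    let ?I = "LBINT t:{0<..<T}. N l (u' t)"
    have I: "0 \<le> ?I"
      unfolding set_lebesgue_integral_def by (intro Bochner_Integration.integral_nonneg) (simp add: N_nonneg)
    have "l2norm \<Omega> (\<lambda>x. uh T x - u T x) \<le> l2norm \<Omega> (\<lambda>x. uh0 x - R \<T> u0 x)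
        + 2 * (LBINT t:{0<..<T}. \<bar>C\<bar> * ?h * N l (u' t)) + l2norm \<Omega> (\<lambda>x. R \<T> (u T) x - u T x)"
      using reg int by (intro error_bound ritz_le set_integrable_mult_right) auto
    also have "\<dots> \<le> l2norm \<Omega> (\<lambda>x. uh0 x - R \<T> u0 x) + 2 * (\<bar>C\<bar> * ?h * ?I) + \<bar>C\<bar> * ?h * N l (u T)"
      using ritz_le[OF reg(1)] by simp
    also have "\<dots> \<le> C' * l2norm \<Omega> (\<lambda>x. uh0 x - R \<T> u0 x) + C' * ?h * (N l (u T) + ?I)"
    proof -
      have "0 \<le> \<bar>C\<bar> * l2norm \<Omega> (\<lambda>x. uh0 x - R \<T> u0 x)" "0 \<le> ?h * ?I" "0 \<le> ?h * N l (u T)"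
          "0 \<le> \<bar>C\<bar> * (?h * N l (u T))"
        using h I N_nonneg by (auto simp: l2norm_nonneg)
      then show ?thesis unfolding C'_def by (simp add: algebra_simps)
    qed
    finally show "l2norm \<Omega> (\<lambda>x. uh T x - u T x)
      \<le> C' * l2norm \<Omega> (\<lambda>x. uh0 x - R \<T> u0 x) + C' * ?h * (N l (u T) + ?I)" .
  qed
qed

end
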